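(* Let $S$ be any interval exchange transformation on $[0,1)$. There exists a dense open set $\Omega_a(S)\subset \mathrm{IET}_a([0,1))$ such that for every $T\in\Omega_a(S)$, the subgroup $\langle S,T\rangle$ of $\mathrm{IET}([0,1))$ generated by $S$ and $T$ is not free of rank $2$.
   Context: $\mathrm{IET}([0,1))$ is the group (under composition) of interval exchange transformations (IETs) of $[0,1)$: right-continuous bijections $T:[0,1)\to[0,1)$ with finitely many discontinuities that are translations on each interval of continuity. For an IET $T$ with intervals of continuity $I_1,\dots,I_n$ (ordered from left to right, each of the form $[b_{i-1},b_i)$ with $b_0=0$, $b_n=1$), let $\lambda(T)=(l_1,\dots,l_n)$ be the vector of lengths of the $I_i$, and let $\pi(T)=\sigma\in\mathfrak S_n$ be the underlying permutation: $T(I_i)$ is the $\sigma(i)$-th interval from the left among the images $T(I_1),\dots,T(I_n)$. As the $I_i$ are the maximal intervals of continuity, $\sigma(i+1)\neq\sigma(i)+1$ for all $1\le i\le n-1$. $\mathrm{IET}([0,1))$ carries the distance (with values in $[0,\infty]$) $d(S,T)=\|\lambda(S)-\lambda(T)\|_1$ if $\pi(S)=\pi(T)$ and $d(S,T)=\infty$ otherwise; open and dense refer to the topology it induces. A permutation $\sigma\in\mathfrak S_n$ is non admissible if there exists $k\in\{1,\dots,n\}$ such that $\sigma(k)=k$ and $\sigma(\{1,\dots,k\})=\{1,\dots,k\}$; otherwise it is admissible. An IET $T$ is admissible if $\pi(T)$ is admissible, and $\mathrm{IET}_a([0,1))$ is the set of admissible IETs on $[0,1)$. *)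

theory Defs
  imports "HOL-Analysis.Analysis" "HOL-Algebra.Bij" "HOL-Algebra.Generated_Groups"
begin

section \<open>Interval exchange transformations of \<open>[0,1)\<close>\<close>

definition iet_disc :: "(real \<Rightarrow> real) \<Rightarrow> real set" where
  "iet_disc f = {x \<in> {0..<1}. \<not> continuous (at x within {0..<1}) f}"

text \<open>
  For finitely many discontinuities, \<open>iet_breaks f = [b\<^sub>0, \<dots>, b\<^sub>n]\<close> with
  \<open>0 = b\<^sub>0 < \<dots> < b\<^sub>n = 1\<close>, and \<open>iet_piece f i = [b\<^sub>i\<^sub>-\<^sub>1, b\<^sub>i)\<close>, for \<open>i \<in> {1..n}\<close>, are the
  maximal intervals of continuity of \<open>f\<close>. All data indexed by pieces is indexed from 1 to
  \<open>n = iet_num f\<close>.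
\<close>

definition iet_breaks :: "(real \<Rightarrow> real) \<Rightarrow> real list" where
  "iet_breaks f = sorted_list_of_set ({0, 1} \<union> iet_disc f)"

definition iet_num :: "(real \<Rightarrow> real) \<Rightarrow> nat" where
  "iet_num f = length (iet_breaks f) - 1"

definition iet_piece :: "(real \<Rightarrow> real) \<Rightarrow> nat \<Rightarrow> real set" where
  "iet_piece f i = {iet_breaks f ! (i - 1)..<iet_breaks f ! i}"

text \<open>
  A transformation is represented by its extension to \<open>real\<close> that takes the value
  \<open>undefined\<close> outside \<open>[0,1)\<close>; the one-sided limit at \<open>x < 1\<close> only involves points of \<open>[0,1)\<close>.
\<close>

definition IET :: "(real \<Rightarrow> real) set" where
  "IET = {f \<in> Bij {0..<1}.
      (\<forall>x\<in>{0..<1}. continuous (at_right x) f) \<and>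
      finite (iet_disc f) \<and>
      (\<forall>i\<in>{1..iet_num f}. \<exists>c. \<forall>x\<in>iet_piece f i. f x = x + c)}"

definition iet_group :: "(real \<Rightarrow> real) monoid" where
  "iet_group = (BijGroup {0..<1})\<lparr>carrier := IET\<rparr>"

definition iet_length :: "(real \<Rightarrow> real) \<Rightarrow> nat \<Rightarrow> real" where
  "iet_length f i = iet_breaks f ! i - iet_breaks f ! (i - 1)"

text \<open>
  The rank of the image of the \<open>i\<close>-th piece is one plus the number of images of pieces that
  lie to its left. The permutation fixes everything outside \<open>{1..n}\<close>, so that it
  determines an element of \<open>\<SS>(n)\<close> only together with \<open>n = iet_num f\<close>.
\<close>

definition iet_perm :: "(real \<Rightarrow> real) \<Rightarrow> nat \<Rightarrow> nat" where
  "iet_perm f i =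
     (if i \<in> {1..iet_num f}
      then Suc (card {j \<in> {1..iet_num f}.
             \<forall>y \<in> f ` iet_piece f j. \<forall>z \<in> f ` iet_piece f i. y < z})
      else i)"

definition iet_dist :: "(real \<Rightarrow> real) \<Rightarrow> (real \<Rightarrow> real) \<Rightarrow> ennreal" where
  "iet_dist f g =
     (if iet_num f = iet_num g \<and> iet_perm f = iet_perm g
      then ennreal (\<Sum>i = 1..iet_num f. \<bar>iet_length f i - iet_length g i\<bar>)
      else \<infinity>)"

definition iet_open :: "(real \<Rightarrow> real) set \<Rightarrow> bool" where
  "iet_open U \<longleftrightarrow> U \<subseteq> IET \<and>
     (\<forall>f\<in>U. \<exists>e>0. \<forall>g\<in>IET. iet_dist f g < ennreal e \<longrightarrow> g \<in> U)"

definition iet_topology :: "(real \<Rightarrow> real) topology" where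
  "iet_topology = topology iet_open"

lemma istopology_iet_open: "istopology iet_open"
  unfolding istopology_def
proof (intro conjI allI impI)
  fix U V assume U: "iet_open U" and V: "iet_open V"
  show "iet_open (U \<inter> V)"
    unfolding iet_open_def
  proof (intro conjI ballI)
    show "U \<inter> V \<subseteq> IET" using U by (auto simp: iet_open_def)
    fix f assume "f \<in> U \<inter> V"
    then obtain a b where ab: "a > 0" "b > 0"
      "\<And>g. g \<in> IET \<Longrightarrow> iet_dist f g < ennreal a \<Longrightarrow> g \<in> U"
      "\<And>g. g \<in> IET \<Longrightarrow> iet_dist f g < ennreal b \<Longrightarrow> g \<in> V"
      using U V unfolding iet_open_def by (metis IntD1 IntD2)
    have "ennreal (min a b) \<le> ennreal a" "ennreal (min a b) \<le> ennreal b"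
      by (auto intro: ennreal_leI)
    then have "\<forall>g\<in>IET. iet_dist f g < ennreal (min a b) \<longrightarrow> g \<in> U \<inter> V"
      using ab(3,4) by (auto dest: less_le_trans)
    then show "\<exists>e>0. \<forall>g\<in>IET. iet_dist f g < ennreal e \<longrightarrow> g \<in> U \<inter> V"
      using ab(1,2) by (intro exI[of _ "min a b"]) simp
  qed
next
  fix K assume K: "\<forall>U\<in>K. iet_open U"
  show "iet_open (\<Union>K)"
    unfolding iet_open_def
  proof (intro conjI ballI)
    show "\<Union>K \<subseteq> IET" using K by (auto simp: iet_open_def)
    fix f assume "f \<in> \<Union>K"
    then obtain U where U: "U \<in> K" "f \<in> U" by blast
    then show "\<exists>e>0. \<forall>g\<in>IET. iet_dist f g < ennreal e \<longrightarrow> g \<in> \<Union>K"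
      using K unfolding iet_open_def by (meson UnionI)
  qed
qed

lemma openin_iet_topology: "openin iet_topology U \<longleftrightarrow> iet_open U"
  by (simp add: iet_topology_def istopology_iet_open)

lemma topspace_iet_topology: "topspace iet_topology = IET"
proof -
  have "iet_open IET"
    by (auto simp: iet_open_def intro: exI[of _ 1])
  then show ?thesis
    unfolding topspace_def openin_iet_topology by (auto simp: iet_open_def)
qed

definition admissible_perm :: "nat \<Rightarrow> (nat \<Rightarrow> nat) \<Rightarrow> bool" where
  "admissible_perm n \<sigma> \<longleftrightarrow> \<not> (\<exists>k\<in>{1..n}. \<sigma> k = k \<and> \<sigma> ` {1..k} = {1..k})"

definition IET_a :: "(real \<Rightarrow> real) set" where
  "IET_a = {f \<in> IET. admissible_perm (iet_num f) (iet_perm f)}"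

section \<open>Free groups of finite rank\<close>

text \<open>A letter \<open>(x, True)\<close> stands for \<open>x\<close> and \<open>(x, False)\<close> for its inverse.\<close>

definition reduced_word :: "('a \<times> bool) list \<Rightarrow> bool" where
  "reduced_word w \<longleftrightarrow>
     (\<forall>i. Suc i < length w \<longrightarrow> \<not> (fst (w ! i) = fst (w ! Suc i) \<and> snd (w ! i) \<noteq> snd (w ! Suc i)))"

definition word_value :: "('a, 'b) monoid_scheme \<Rightarrow> ('a \<times> bool) list \<Rightarrow> 'a" where
  "word_value G w =
     foldr (\<lambda>(x, s) y. (if s then x else inv\<^bsub>G\<^esub> x) \<otimes>\<^bsub>G\<^esub> y) w \<one>\<^bsub>G\<^esub>"

definition free_basis :: "('a, 'b) monoid_scheme \<Rightarrow> 'a set \<Rightarrow> bool" where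
  "free_basis G B \<longleftrightarrow>
     B \<subseteq> carrier G \<and> generate G B = carrier G \<and>
     (\<forall>w. fst ` set w \<subseteq> B \<and> reduced_word w \<and> w \<noteq> [] \<longrightarrow> word_value G w \<noteq> \<one>\<^bsub>G\<^esub>)"

definition free_of_rank :: "('a, 'b) monoid_scheme \<Rightarrow> nat \<Rightarrow> bool" where
  "free_of_rank G r \<longleftrightarrow> group G \<and> (\<exists>B. finite B \<and> card B = r \<and> free_basis G B)"

end

theory Submission
  imports Defs
begin

text \<open>
  Along the direction \<open>v\<^sub>j = j - \<sigma>(j)\<close> in the space of lengths, every translation length of an
  exchange with admissible permutation \<open>\<sigma>\<close> strictly increases. Start from lengths in \<open>\<int>/N\<close>, move
  them by \<open>\<delta>v\<close> and let \<open>T\<close> be close to the result. Then every iterate of \<open>T\<close> moves points to the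
  right modulo \<open>1/N\<close>, at a speed comparable to \<open>\<delta>\<close>. The power \<open>A = T\<^bsup>N!\<^esup>\<close> is a translation of size
  \<open>O(\<delta>)\<close> on each interval \<open>[j/N, (j+1)/N)\<close> shrunk by \<open>O(\<delta>)\<close>. Hence \<open>A\<close> and \<open>B = S A S\<^sup>-\<^sup>1\<close>
  commute outside the \<open>O(\<delta>)\<close>-neighbourhood of a finite set \<open>F\<close> that depends only on \<open>S\<close> and
  \<open>N\<close>, and this neighbourhood contains the support of \<open>C = A\<^sup>-\<^sup>1 B\<^sup>-\<^sup>1 A B\<close>. For a suitable
  \<open>m\<close>, independent of \<open>\<delta>\<close>, the drift of \<open>T\<^sup>m\<close> displaces the neighbourhood from itself, so \<open>C\<close>
  commutes with \<open>T\<^sup>m C T\<^sup>-\<^sup>m\<close>.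

  If \<open>S\<close> and \<open>T\<close> generated a free group of rank 2, then by counting homomorphisms every pair of
  elements of a finite group would be the image of \<open>(S, T)\<close> under a homomorphism, and would satisfy
  the same relation. A rotation and a shear in \<open>SL\<^sub>2(\<int>/q)\<close> violate it for large \<open>q\<close>.
\<close>

section \<open>Homomorphisms from a free group to a finite group\<close>

lemma (in group) word_value_closed:
  "fst ` set w \<subseteq> carrier G \<Longrightarrow> word_value G w \<in> carrier G"
  by (induction w) (auto simp: word_value_def split: prod.splits)

lemma (in group) word_value_append:
  "fst ` set u \<subseteq> carrier G \<Longrightarrow> fst ` set w \<subseteq> carrier G \<Longrightarrow>
     word_value G (u @ w) = word_value G u \<otimes> word_value G w"
proof (induction u)
  case Nil
  then show ?case using word_value_closed[of w] by (simp add: word_value_def)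
next
  case (Cons a u)
  obtain x s where a: "a = (x, s)" by fastforce
  have "word_value G u \<in> carrier G" "word_value G w \<in> carrier G" "x \<in> carrier G"
    using Cons.prems a by (auto intro!: word_value_closed)
  then show ?case using Cons a by (auto simp: word_value_def m_assoc)
qed

lemma (in group) word_value_inverse:
  "fst ` set w \<subseteq> carrier G \<Longrightarrow>
     word_value G (rev (map (apsnd Not) w)) = inv (word_value G w)"
proof (induction w)
  case Nil
  then show ?case by (simp add: word_value_def)
next
  case (Cons a w)
  obtain x s where a: "a = (x, s)" by fastforce
  have c: "word_value G w \<in> carrier G" "x \<in> carrier G" 
    "fst ` set (rev (map (apsnd Not) w)) \<subseteq> carrier G"
    using Cons.prems a by (auto intro!: word_value_closed)
  have "word_value G (rev (map (apsnd Not) (a # w))) =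
      inv (word_value G w) \<otimes> word_value G [(x, \<not> s)]"
    using c Cons word_value_append[of "rev (map (apsnd Not) w)" "[(x, \<not> s)]"] a by auto
  also have "\<dots> = inv (word_value G (a # w))"
    using c a by (auto simp: word_value_def inv_mult_group)
  finally show ?case .
qed

lemma (in group) word_value_cancel:
  assumes "fst ` set (u @ (x, s) # (x, \<not> s) # v) \<subseteq> carrier G"
  shows "word_value G (u @ (x, s) # (x, \<not> s) # v) = word_value G (u @ v)"
proof -
  have c: "word_value G v \<in> carrier G" "x \<in> carrier G"
    using assms by (auto intro!: word_value_closed)
  have "word_value G ((x, s) # (x, \<not> s) # v) = word_value G v"
    using c by (auto simp: word_value_def m_assoc[symmetric])
  then show ?thesis
    using assms word_value_append[of u v] word_value_append[of u "(x, s) # (x, \<not> s) # v"]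
    by (auto simp: image_Un)
qed

lemma not_reduced_wordE:
  assumes "\<not> reduced_word w"
  obtains u x s v where "w = u @ (x, s) # (x, \<not> s) # v"
proof -
  obtain i where i: "Suc i < length w" "fst (w ! i) = fst (w ! Suc i)" "snd (w ! i) \<noteq> snd (w ! Suc i)"
    using assms by (auto simp: reduced_word_def)
  have "w = take i w @ w ! i # w ! Suc i # drop (Suc (Suc i)) w"
    using i(1) by (metis Cons_nth_drop_Suc Suc_lessD append_take_drop_id)
  moreover have "w ! i = (fst (w ! i), snd (w ! i))" "w ! Suc i = (fst (w ! i), \<not> snd (w ! i))"
    using i by (auto simp: prod_eq_iff)
  ultimately show ?thesis using that by metis
qed

text \<open>Induction on the length of \<open>w\<close>: a nonempty word of trivial value in
  \<open>H\<close> cannot be reduced, because \<open>B\<close> is a free basis. Deleting an adjacent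
  inverse pair shortens it and changes neither its value in \<open>H\<close> nor the value of its
  image in \<open>Q\<close>.\<close>

lemma free_basis_word_value_one:
  assumes "group H" "free_basis H B" "group Q" "\<alpha> \<in> B \<rightarrow> carrier Q"
    and "fst ` set w \<subseteq> B" "word_value H w = \<one>\<^bsub>H\<^esub>"
  shows "word_value Q (map (apfst \<alpha>) w) = \<one>\<^bsub>Q\<^esub>"
  using assms(5,6)
proof (induction w rule: length_induct)
  case (1 w)
  interpret H: group H by fact
  interpret Q: group Q by fact
  have B: "B \<subseteq> carrier H" using assms(2) by (simp add: free_basis_def)
  show ?case
  proof (cases "w = []")
    case True
    then show ?thesis by (simp add: word_value_def)
  next
    case False
    then have "\<not> reduced_word w" using 1 assms(2) unfolding free_basis_def by blast
    then obtain u x s v where w: "w = u @ (x, s) # (x, \<not> s) # v" by (rule not_reduced_wordE)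
    have "fst ` set (u @ (x, s) # (x, \<not> s) # v) \<subseteq> carrier H" using 1(2) B w by blast
    then have "word_value H (u @ v) = \<one>\<^bsub>H\<^esub>"
      using 1(3) w H.word_value_cancel[of u x s v] by simp
    then have "word_value Q (map (apfst \<alpha>) (u @ v)) = \<one>\<^bsub>Q\<^esub>"
      using 1(1)[rule_format, of "u @ v"] 1(2) w by (simp add: image_Un)
    moreover have "fst ` set (map (apfst \<alpha>) w) \<subseteq> carrier Q" using 1(2) assms(4) by force
    ultimately show ?thesis
      using Q.word_value_cancel[of "map (apfst \<alpha>) u" "\<alpha> x" s "map (apfst \<alpha>) v"] w by (auto simp: image_Un)
  qed
qed

lemma (in group) generate_word_value:
  assumes "h \<in> generate G B" "B \<subseteq> carrier G"
  shows "\<exists>w. fst ` set w \<subseteq> B \<and> word_value G w = h"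
  using assms(1)
proof induction
  case one
  then show ?case by (intro exI[of _ "[]"]) (simp add: word_value_def)
next
  case (incl h)
  then show ?case using assms by (intro exI[of _ "[(h, True)]"]) (auto simp: word_value_def)
next
  case (inv h)
  then show ?case using assms by (intro exI[of _ "[(h, False)]"]) (auto simp: word_value_def)
next
  case (eng h1 h2)
  then obtain u v where "fst ` set u \<subseteq> B" "word_value G u = h1" "fst ` set v \<subseteq> B" "word_value G v = h2"
    by blast
  then show ?case using assms word_value_append[of u v]
    by (intro exI[of _ "u @ v"]) (auto simp: image_Un)
qed

text \<open>The universal property of a free group, derived from the definition by reduced words. An
  element is written as a word over \<open>B\<close> and the word is relabelled by
  \<open>\<alpha>\<close>. This is well defined: two words \<open>u\<close>, \<open>w\<close> of
  equal value give the word \<open>u w^-1\<close> of trivial value, to which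
  \<open>free_basis_word_value_one\<close> applies.\<close>

lemma free_basis_hom_extension:
  assumes "group H" "free_basis H B" "group Q" "\<alpha> \<in> B \<rightarrow> carrier Q"
  shows "\<exists>\<phi>\<in>hom H Q. \<forall>x\<in>B. \<phi> x = \<alpha> x"
proof -
  interpret H: group H by fact
  interpret Q: group Q by fact
  have B: "B \<subseteq> carrier H" and gen: "generate H B = carrier H"
    using assms(2) by (auto simp: free_basis_def)
  let ?m = "map (apfst \<alpha>)"
  have img: "fst ` set (?m w) \<subseteq> carrier Q" if "fst ` set w \<subseteq> B" for w
    using that assms(4) by force
  have uniq: "word_value Q (?m u) = word_value Q (?m w)"
    if "fst ` set u \<subseteq> B" "fst ` set w \<subseteq> B" "word_value H u = word_value H w" for u w
  proof -
    let ?i = "\<lambda>w. rev (map (apsnd Not) w)"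
    have iB: "fst ` set (?i w) \<subseteq> B" using that by force
    have "word_value H (u @ ?i w) = \<one>\<^bsub>H\<^esub>"
      using that B iB H.word_value_append[of u "?i w"] H.word_value_inverse[of w] H.word_value_closed[of w]
      by force
    then have "word_value Q (?m (u @ ?i w)) = \<one>\<^bsub>Q\<^esub>"
      using free_basis_word_value_one[OF assms] that iB by (metis image_Un set_append Un_least)
    moreover have "?m (?i w) = ?i (?m w)" by (simp add: rev_map apfst_def apsnd_def map_prod_def split_def)
    ultimately have "word_value Q (?m u) \<otimes>\<^bsub>Q\<^esub> inv\<^bsub>Q\<^esub> word_value Q (?m w) = \<one>\<^bsub>Q\<^esub>"
      using Q.word_value_append[OF img[OF that(1)] img[OF iB]] Q.word_value_inverse[OF img[OF that(2)]]
      by (metis map_append)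
    then show ?thesis
      using img that Q.word_value_closed by (metis Q.inv_closed Q.inv_equality Q.inv_inv)
  qed
  have ex: "\<exists>w. fst ` set w \<subseteq> B \<and> word_value H w = h" if "h \<in> carrier H" for h
    using H.generate_word_value[of h B] that B gen by auto
  define \<omega> where "\<omega> h = (SOME w. fst ` set w \<subseteq> B \<and> word_value H w = h)" for h
  have \<omega>: "fst ` set (\<omega> h) \<subseteq> B" "word_value H (\<omega> h) = h" if "h \<in> carrier H" for h
    using someI_ex[OF ex[OF that]] by (auto simp: \<omega>_def)
  define \<phi> where "\<phi> h = word_value Q (?m (\<omega> h))" for h
  have \<phi>: "\<phi> h = word_value Q (?m w)" if "fst ` set w \<subseteq> B" "word_value H w = h" "h \<in> carrier H" for w h
    unfolding \<phi>_def using uniq \<omega> that by blast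
  have "\<phi> \<in> hom H Q"
  proof (rule homI)
    fix h assume "h \<in> carrier H"
    then show "\<phi> h \<in> carrier Q" unfolding \<phi>_def by (intro Q.word_value_closed img \<omega>)
  next
    fix h k assume hk: "h \<in> carrier H" "k \<in> carrier H"
    then have "\<phi> (h \<otimes>\<^bsub>H\<^esub> k) = word_value Q (?m (\<omega> h @ \<omega> k))"
      using \<omega> B H.word_value_append[of "\<omega> h" "\<omega> k"] by (intro \<phi>) (auto simp: image_Un)
    then show "\<phi> (h \<otimes>\<^bsub>H\<^esub> k) = \<phi> h \<otimes>\<^bsub>Q\<^esub> \<phi> k"
      unfolding \<phi>_def using hk \<omega> Q.word_value_append[OF img img] by simp
  qed
  moreover have "\<phi> x = \<alpha> x" if "x \<in> B" for x
  proof -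
    have "\<phi> x = word_value Q (?m [(x, True)])"
      using that B by (intro \<phi>) (auto simp: word_value_def)
    moreover have "\<alpha> x \<in> carrier Q" using that assms(4) by auto
    ultimately show ?thesis by (simp add: word_value_def)
  qed
  ultimately show ?thesis by blast
qed

lemma hom_eq_on_generate:
  assumes "group H" "group Q" "\<phi> \<in> hom H Q" "\<psi> \<in> hom H Q" "X \<subseteq> carrier H"
    and "\<And>x. x \<in> X \<Longrightarrow> \<phi> x = \<psi> x" "h \<in> generate H X"
  shows "\<phi> h = \<psi> h"
proof -
  interpret H: group H by fact
  interpret p: group_hom H Q \<phi> using assms by (simp add: group_hom_def group_hom_axioms_def)
  interpret q: group_hom H Q \<psi> using assms by (simp add: group_hom_def group_hom_axioms_def)
  show ?thesis
    using assms(7)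
  proof induction
    case (eng h1 h2)
    then show ?case using H.generate_in_carrier[OF assms(5)] by simp
  qed (use assms in \<open>auto simp: subset_iff\<close>)
qed

text \<open>
  A homomorphism to a finite group \<open>Q\<close> is determined by the images of the generators \<open>x, y\<close>,
  and there are \<open>|Q|\<^sup>2\<close> of them, so every pair occurs.
\<close>

lemma free_rank2_hom_finite:
  assumes "free_of_rank H 2" "group Q" "finite (carrier Q)"
    and "x \<in> carrier H" "y \<in> carrier H" "generate H {x, y} = carrier H"
    and "s \<in> carrier Q" "t \<in> carrier Q"
  obtains \<phi> where "\<phi> \<in> hom H Q" "\<phi> x = s" "\<phi> y = t"
proof -
  have H: "group H" using assms by (simp add: free_of_rank_def)
  obtain B where B: "card B = 2" "free_basis H B" using assms by (auto simp: free_of_rank_def)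
  then obtain a b where ab: "B = {a, b}" "a \<noteq> b" by (auto simp: card_2_iff)
  have abH: "a \<in> carrier H" "b \<in> carrier H" using B ab by (auto simp: free_basis_def)
  have "\<exists>\<phi>\<in>hom H Q. \<phi> a = u \<and> \<phi> b = v" if "u \<in> carrier Q" "v \<in> carrier Q" for u v
    using free_basis_hom_extension[OF H B(2) assms(2), of "\<lambda>z. if z = a then u else v"] that ab by auto
  then obtain \<Phi> where \<Phi>: "\<And>u v. u \<in> carrier Q \<Longrightarrow> v \<in> carrier Q \<Longrightarrow>
      \<Phi> u v \<in> hom H Q \<and> \<Phi> u v a = u \<and> \<Phi> u v b = v" by metis
  let ?QQ = "carrier Q \<times> carrier Q"
  let ?f = "\<lambda>(u, v). (\<Phi> u v x, \<Phi> u v y)"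
  \<comment> \<open>Two of the homomorphisms that agree on \<open>x\<close> and \<open>y\<close>
    agree on all of \<open>H\<close>, hence on the basis elements \<open>a\<close> and
    \<open>b\<close>, whose images are the parameters \<open>u\<close> and \<open>v\<close>.\<close>
  have "inj_on ?f ?QQ"
  proof (rule inj_onI, clarsimp)
    fix u v u' v'
    assume c: "u \<in> carrier Q" "v \<in> carrier Q" "u' \<in> carrier Q" "v' \<in> carrier Q"
      and eq: "\<Phi> u v x = \<Phi> u' v' x" "\<Phi> u v y = \<Phi> u' v' y"
    have "\<Phi> u v h = \<Phi> u' v' h" if "h \<in> carrier H" for h
      using hom_eq_on_generate[OF H assms(2), of "\<Phi> u v" "\<Phi> u' v'" "{x, y}" h] \<Phi> c eq assms that by auto
    then show "u = u' \<and> v = v'" using \<Phi> c abH by metis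
  qed
  moreover have "?f ` ?QQ \<subseteq> ?QQ" using \<Phi> assms(4,5) by (fastforce simp: hom_def)
  ultimately have "?f ` ?QQ = ?QQ" using assms(3) by (simp add: endo_inj_surj)
  then have "(s, t) \<in> ?f ` ?QQ" using assms by simp
  then show ?thesis using that \<Phi> by auto
qed

section \<open>A relation that fails in a finite group\<close>

text \<open>The commutator \<open>A^-1 B^-1 A B\<close>. Grouped as the inverse of
  \<open>B A\<close> times \<open>A B\<close>, it visibly fixes every point at which
  \<open>A B\<close> and \<open>B A\<close> agree.\<close>

definition conj_commutator :: "('a, 'b) monoid_scheme \<Rightarrow> nat \<Rightarrow> 'a \<Rightarrow> 'a \<Rightarrow> 'a" where
  "conj_commutator G p s t =
     (let A = t [^]\<^bsub>G\<^esub> p; B = s \<otimes>\<^bsub>G\<^esub> A \<otimes>\<^bsub>G\<^esub> inv\<^bsub>G\<^esub> s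
      in inv\<^bsub>G\<^esub> (B \<otimes>\<^bsub>G\<^esub> A) \<otimes>\<^bsub>G\<^esub> (A \<otimes>\<^bsub>G\<^esub> B))"

text \<open>A fixed word equation in \<open>s\<close> and \<open>t\<close>, hence inherited by
  homomorphic images. It is to hold for suitable exchanges and to fail in some finite group.\<close>

definition displaced_commute :: "('a, 'b) monoid_scheme \<Rightarrow> nat \<Rightarrow> nat \<Rightarrow> 'a \<Rightarrow> 'a \<Rightarrow> bool" where
  "displaced_commute G p m s t \<longleftrightarrow>
     (let C = conj_commutator G p s t;
          D = t [^]\<^bsub>G\<^esub> m \<otimes>\<^bsub>G\<^esub> C \<otimes>\<^bsub>G\<^esub> inv\<^bsub>G\<^esub> (t [^]\<^bsub>G\<^esub> m)
      in C \<otimes>\<^bsub>G\<^esub> D = D \<otimes>\<^bsub>G\<^esub> C)"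

lemma (in group) conj_commutator_closed:
  "s \<in> carrier G \<Longrightarrow> t \<in> carrier G \<Longrightarrow> conj_commutator G p s t \<in> carrier G"
  by (simp add: conj_commutator_def Let_def)

lemma (in group_hom) hom_conj_commutator:
  "s \<in> carrier G \<Longrightarrow> t \<in> carrier G \<Longrightarrow>
     h (conj_commutator G p s t) = conj_commutator H p (h s) (h t)"
  by (simp add: conj_commutator_def Let_def hom_nat_pow)

lemma (in group_hom) hom_displaced_commute:
  assumes "s \<in> carrier G" "t \<in> carrier G" "displaced_commute G p m s t"
  shows "displaced_commute H p m (h s) (h t)"
proof -
  define C where "C = conj_commutator G p s t"
  define D where "D = t [^] m \<otimes> C \<otimes> inv (t [^] m)"
  have C: "C \<in> carrier G" "h C = conj_commutator H p (h s) (h t)"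
    using assms hom_conj_commutator G.conj_commutator_closed by (auto simp: C_def)
  have D: "D \<in> carrier G" "h D = h t [^]\<^bsub>H\<^esub> m \<otimes>\<^bsub>H\<^esub> h C \<otimes>\<^bsub>H\<^esub> inv\<^bsub>H\<^esub> (h t [^]\<^bsub>H\<^esub> m)"
    using assms C by (auto simp: D_def hom_nat_pow)
  have "C \<otimes> D = D \<otimes> C" using assms(3) by (simp add: displaced_commute_def Let_def C_def D_def)
  then have "h C \<otimes>\<^bsub>H\<^esub> h D = h D \<otimes>\<^bsub>H\<^esub> h C" using C D by (metis hom_mult)
  then show ?thesis by (simp add: displaced_commute_def Let_def C D)
qed

section \<open>Matrices modulo \<open>q\<close>\<close>

definition mat_act :: "int \<Rightarrow> int \<times> int \<times> int \<times> int \<Rightarrow> int \<times> int \<Rightarrow> int \<times> int" where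
  "mat_act q = (\<lambda>(a, b, c, d). restrict (\<lambda>(x, y). ((a * x + b * y) mod q, (c * x + d * y) mod q))
     ({0..<q} \<times> {0..<q}))"

text \<open>\<open>SL_2(Z/q)\<close> is realised by its action on pairs of residues, inside the
  symmetric group of these pairs. The group laws then come from \<open>BijGroup\<close>, and
  finiteness from that of the set acted on.\<close>

abbreviation mat_grp :: "int \<Rightarrow> (int \<times> int \<Rightarrow> int \<times> int) monoid" where
  "mat_grp q \<equiv> BijGroup ({0..<q} \<times> {0..<q})"

lemma mat_act_compose:
  assumes "q > 0"
  shows "compose ({0..<q} \<times> {0..<q}) (mat_act q (a, b, c, d)) (mat_act q (a', b', c', d')) =
    mat_act q (a * a' + b * c', a * b' + b * d', c * a' + d * c', c * b' + d * d')"
proof (rule ext)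
  fix z :: "int \<times> int"
  have *: "(u * (X mod q) + v * (Y mod q)) mod q = (u * X + v * Y) mod q" for u v X Y
    by (metis mod_add_cong mod_mult_right_eq)
  show "compose ({0..<q} \<times> {0..<q}) (mat_act q (a, b, c, d)) (mat_act q (a', b', c', d')) z =
    mat_act q (a * a' + b * c', a * b' + b * d', c * a' + d * c', c * b' + d * d') z"
    using assms by (cases z) (auto simp: mat_act_def compose_def * algebra_simps)
qed

lemma mat_act_one: "mat_act q (1, 0, 0, 1) = \<one>\<^bsub>mat_grp q\<^esub>"
  by (rule ext) (auto simp: mat_act_def BijGroup_def)

text \<open>The adjugate matrix \<open>(d, -b, -c, a)\<close> is a two-sided inverse when the
  determinant is 1.\<close>

lemma mat_act_Bij:
  assumes "q > 0" "a * d - b * c = 1"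
  shows "mat_act q (a, b, c, d) \<in> Bij ({0..<q} \<times> {0..<q})"
proof -
  let ?X = "{0..<q} \<times> {0..<q}"
  let ?f = "mat_act q (a, b, c, d)" and ?g = "mat_act q (d, -b, -c, a)"
  have det: "d * a - b * c = 1" "a * d - c * b = 1" "d * a - c * b = 1"
    using assms(2) by (simp_all add: mult.commute)
  have fg: "compose ?X ?f ?g = mat_act q (1, 0, 0, 1)" "compose ?X ?g ?f = mat_act q (1, 0, 0, 1)"
    using assms(2) det by (simp_all add: mat_act_compose[OF assms(1)] mult.commute)
  have one: "mat_act q (1, 0, 0, 1) z = z" if "z \<in> ?X" for z
    using that by (auto simp: mat_act_def)
  have inv: "?f (?g z) = z" "?g (?f z) = z" if "z \<in> ?X" for z
    using fg[THEN fun_cong, of z] one that by (simp_all add: compose_def)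
  have "?f \<in> ?X \<rightarrow> ?X" "?g \<in> ?X \<rightarrow> ?X" using assms by (auto simp: mat_act_def)
  then have "?f ` ?X \<subseteq> ?X" "?g ` ?X \<subseteq> ?X" by blast+
  then have "bij_betw ?f ?X ?X" using inv by (intro bij_betw_byWitness[of _ ?g]) blast+
  then show ?thesis by (auto simp: Bij_def mat_act_def)
qed

lemma mat_act_mult:
  assumes "q > 0" "a * d - b * c = 1" "a' * d' - b' * c' = 1"
  shows "mat_act q (a, b, c, d) \<otimes>\<^bsub>mat_grp q\<^esub> mat_act q (a', b', c', d') =
    mat_act q (a * a' + b * c', a * b' + b * d', c * a' + d * c', c * b' + d * d')"
  using mat_act_Bij assms mat_act_compose[OF assms(1)] by (simp add: BijGroup_def)

lemma mat_act_inv: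
  assumes "q > 0" "a * d - b * c = 1"
  shows "inv\<^bsub>mat_grp q\<^esub> mat_act q (a, b, c, d) = mat_act q (d, -b, -c, a)"
proof -
  interpret group "mat_grp q" by (rule group_BijGroup)
  show ?thesis
  proof (rule inv_equality)
    show "mat_act q (d, -b, -c, a) \<otimes>\<^bsub>mat_grp q\<^esub> mat_act q (a, b, c, d) = \<one>\<^bsub>mat_grp q\<^esub>"
      using assms by (subst mat_act_mult) (simp_all add: mult.commute mat_act_one)
  qed (use mat_act_Bij assms in \<open>auto simp: BijGroup_def mult.commute\<close>)
qed

lemma mat_act_shear_pow:
  assumes "q > 0"
  shows "mat_act q (1, 1, 0, 1) [^]\<^bsub>mat_grp q\<^esub> n = mat_act q (1, int n, 0, 1)"
proof (induction n)
  case 0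
  interpret group "mat_grp q" by (rule group_BijGroup)
  show ?case by (simp add: mat_act_one)
next
  case (Suc n)
  interpret group "mat_grp q" by (rule group_BijGroup)
  show ?case using assms by (simp add: Suc mat_act_mult add.commute)
qed

text \<open>Here \<open>A\<close> is the upper shear with entry \<open>P\<close>, and conjugation by
  the quarter turn makes \<open>B\<close> the lower shear with entry \<open>-P\<close>. The rest is
  multiplication of integer matrices.\<close>

lemma shear_rotation_conj_commutator:
  fixes q :: int and p :: nat
  assumes "q > 0"
  defines "P \<equiv> int p"
  shows "conj_commutator (mat_grp q) p (mat_act q (0, -1, 1, 0)) (mat_act q (1, 1, 0, 1)) =
    mat_act q (1 - P^2 + P^4, - (P^3), - (P^3), 1 + P^2)"
  unfolding conj_commutator_def Let_def
  by (simp add: assms(1) mat_act_shear_pow mat_act_mult mat_act_inv P_def algebra_simps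
      power2_eq_square power3_eq_cube power4_eq_xxxx)

text \<open>The lower left entries of the integer matrices \<open>C D\<close> and \<open>D C\<close>
  differ by \<open>2 * M * P ^ 6\<close>, which is positive. Modulo a \<open>q\<close> that does not
  divide this number the two products remain different.\<close>

lemma finite_group_not_displaced_commute:
  assumes "p > 0" "m > 0"
  shows "\<exists>(Q :: (int \<times> int \<Rightarrow> int \<times> int) monoid) s t. group Q \<and> finite (carrier Q) \<and>
     s \<in> carrier Q \<and> t \<in> carrier Q \<and> \<not> displaced_commute Q p m s t"
proof -
  define P where "P = int p"
  define M where "M = int m"
  \<comment> \<open>One more than the difference of the two entries, so that \<open>q\<close> cannot
    divide it.\<close>
  define q where "q = 2 * M * P ^ 6 + 1"
  let ?s = "mat_act q (0, -1, 1, 0)" and ?t = "mat_act q (1, 1, 0, 1)"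
  have pos: "0 < 2 * M * P ^ 6" using assms by (simp add: P_def M_def)
  then have q: "q > 0" "1 < q" by (simp_all add: q_def)
  define \<alpha> \<beta> \<gamma> where "\<alpha> = 1 - P^2 + P^4" and "\<beta> = - (P^3)" and "\<gamma> = 1 + P^2"
  have det: "\<alpha> * \<gamma> - \<beta> * \<beta> = 1"
    by (simp add: \<alpha>_def \<beta>_def \<gamma>_def algebra_simps power_numeral_reduce)
  have "\<not> displaced_commute (mat_grp q) p m ?s ?t"
  proof
    assume rel: "displaced_commute (mat_grp q) p m ?s ?t"
    define D where "D = (\<alpha> + M * \<beta>, - M * (\<alpha> + M * \<beta>) + \<beta> + M * \<gamma>, \<beta>, \<gamma> - M * \<beta>)"
    have det': "(\<alpha> + M * \<beta>) * \<gamma> - (\<beta> + M * \<gamma>) * \<beta> = 1"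
      using det by (simp add: algebra_simps)
    have detD: "(\<alpha> + M * \<beta>) * (\<gamma> - M * \<beta>) - (- M * (\<alpha> + M * \<beta>) + \<beta> + M * \<gamma>) * \<beta> = 1"
      using det by (simp add: algebra_simps)
    have C: "conj_commutator (mat_grp q) p ?s ?t = mat_act q (\<alpha>, \<beta>, \<beta>, \<gamma>)"
      using shear_rotation_conj_commutator[OF q(1)] by (simp add: \<alpha>_def \<beta>_def \<gamma>_def P_def)
    have "?t [^]\<^bsub>mat_grp q\<^esub> m \<otimes>\<^bsub>mat_grp q\<^esub> mat_act q (\<alpha>, \<beta>, \<beta>, \<gamma>) = mat_act q (\<alpha> + M * \<beta>, \<beta> + M * \<gamma>, \<beta>, \<gamma>)"
      using q det by (simp add: mat_act_shear_pow mat_act_mult M_def)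
    then have D: "?t [^]\<^bsub>mat_grp q\<^esub> m \<otimes>\<^bsub>mat_grp q\<^esub> mat_act q (\<alpha>, \<beta>, \<beta>, \<gamma>) \<otimes>\<^bsub>mat_grp q\<^esub>
        inv\<^bsub>mat_grp q\<^esub> (?t [^]\<^bsub>mat_grp q\<^esub> m) = mat_act q D"
      using q det' by (simp add: mat_act_shear_pow mat_act_inv mat_act_mult M_def[symmetric] D_def algebra_simps)
    have "mat_act q (\<alpha>, \<beta>, \<beta>, \<gamma>) \<otimes>\<^bsub>mat_grp q\<^esub> mat_act q D =
        mat_act q D \<otimes>\<^bsub>mat_grp q\<^esub> mat_act q (\<alpha>, \<beta>, \<beta>, \<gamma>)"
      using rel D C by (simp add: displaced_commute_def Let_def)
    \<comment> \<open>Evaluation at the first basis vector reads off the first columns, whose lower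
      entries are then compared.\<close>
    then have "mat_act q (\<alpha> * (\<alpha> + M * \<beta>) + \<beta> * \<beta>,
          \<alpha> * (- M * (\<alpha> + M * \<beta>) + \<beta> + M * \<gamma>) + \<beta> * (\<gamma> - M * \<beta>),
          \<beta> * (\<alpha> + M * \<beta>) + \<gamma> * \<beta>,
          \<beta> * (- M * (\<alpha> + M * \<beta>) + \<beta> + M * \<gamma>) + \<gamma> * (\<gamma> - M * \<beta>)) (1, 0) =
        mat_act q ((\<alpha> + M * \<beta>) * \<alpha> + (- M * (\<alpha> + M * \<beta>) + \<beta> + M * \<gamma>) * \<beta>,
          (\<alpha> + M * \<beta>) * \<beta> + (- M * (\<alpha> + M * \<beta>) + \<beta> + M * \<gamma>) * \<gamma>,
          \<beta> * \<alpha> + (\<gamma> - M * \<beta>) * \<beta>, \<beta> * \<beta> + (\<gamma> - M * \<beta>) * \<gamma>) (1, 0)"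
      unfolding D_def mat_act_mult[OF q(1) det detD] mat_act_mult[OF q(1) detD det] by simp
    then have "(\<beta> * (\<alpha> + M * \<beta>) + \<gamma> * \<beta>) mod q = (\<beta> * \<alpha> + (\<gamma> - M * \<beta>) * \<beta>) mod q"
      using q by (simp add: mat_act_def)
    then have "q dvd (\<beta> * (\<alpha> + M * \<beta>) + \<gamma> * \<beta>) - (\<beta> * \<alpha> + (\<gamma> - M * \<beta>) * \<beta>)"
      by (simp add: mod_eq_dvd_iff)
    also have "(\<beta> * (\<alpha> + M * \<beta>) + \<gamma> * \<beta>) - (\<beta> * \<alpha> + (\<gamma> - M * \<beta>) * \<beta>) = 2 * M * \<beta> ^ 2"
      by (simp add: algebra_simps power2_eq_square)
    also have "\<dots> = 2 * M * P ^ 6" by (simp add: \<beta>_def flip: power_mult)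
    finally show False using pos by (auto dest: zdvd_imp_le simp: q_def)
  qed
  moreover have "finite (carrier (mat_grp q))"
  proof -
    have "Bij ({0..<q} \<times> {0..<q}) \<subseteq> ({0..<q} \<times> {0..<q}) \<rightarrow>\<^sub>E ({0..<q} \<times> {0..<q})"
      by (auto simp: Bij_def PiE_def bij_betw_def)
    then have "finite (Bij ({0..<q} \<times> {0..<q}))" by (rule finite_subset) (simp add: finite_PiE)
    then show ?thesis by (simp add: BijGroup_def)
  qed
  moreover have "?s \<in> carrier (mat_grp q)" "?t \<in> carrier (mat_grp q)"
    using mat_act_Bij[OF q(1)] by (auto simp: BijGroup_def)
  ultimately show ?thesis using group_BijGroup by metis
qed

section \<open>Exchanges with given permutation and lengths\<close>

definition is_lengths :: "nat \<Rightarrow> (nat \<Rightarrow> real) \<Rightarrow> bool" where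
  "is_lengths n l \<longleftrightarrow> (\<forall>i\<in>{1..n}. 0 < l i) \<and> (\<Sum>i = 1..n. l i) = 1"

abbreviation pinv :: "(nat \<Rightarrow> nat) \<Rightarrow> nat \<Rightarrow> nat" where
  "pinv \<equiv> Hilbert_Choice.inv"

definition brk :: "(nat \<Rightarrow> real) \<Rightarrow> nat \<Rightarrow> real" where
  "brk l i = (\<Sum>j = 1..i. l j)"

text \<open>The left end point of the image of piece \<open>i\<close>: the images to its left fill
  everything before it.\<close>

definition img_brk :: "nat \<Rightarrow> (nat \<Rightarrow> nat) \<Rightarrow> (nat \<Rightarrow> real) \<Rightarrow> nat \<Rightarrow> real" where
  "img_brk n \<sigma> l i = (\<Sum>j \<in> {j \<in> {1..n}. \<sigma> j < \<sigma> i}. l j)"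

text \<open>The amount by which piece \<open>i\<close> is translated. It is linear in
  \<open>l\<close> and makes sense without positivity, so that it can also be evaluated on
  directions and on error vectors.\<close>

definition shift :: "nat \<Rightarrow> (nat \<Rightarrow> nat) \<Rightarrow> (nat \<Rightarrow> real) \<Rightarrow> nat \<Rightarrow> real" where
  "shift n \<sigma> l i = img_brk n \<sigma> l i - brk l (i - 1)"

definition piece_index :: "(nat \<Rightarrow> real) \<Rightarrow> real \<Rightarrow> nat" where
  "piece_index l x = (LEAST i. x < brk l i)"

definition mk_iet :: "nat \<Rightarrow> (nat \<Rightarrow> nat) \<Rightarrow> (nat \<Rightarrow> real) \<Rightarrow> real \<Rightarrow> real" where
  "mk_iet n \<sigma> l = restrict (\<lambda>x. x + shift n \<sigma> l (piece_index l x)) {0..<1}"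

lemma brk_0 [simp]: "brk l 0 = 0"
  by (simp add: brk_def)

lemma brk_Suc: "brk l (Suc i) = brk l i + l (Suc i)"
  by (simp add: brk_def)

lemma brk_step: "1 \<le> i \<Longrightarrow> brk l i = brk l (i - 1) + l i"
  by (cases i) (simp_all add: brk_Suc)

lemma brk_last: "is_lengths n l \<Longrightarrow> brk l n = 1"
  by (simp add: is_lengths_def brk_def)

lemma is_lengths_pos: "is_lengths n l \<Longrightarrow> 1 \<le> i \<Longrightarrow> i \<le> n \<Longrightarrow> 0 < l i"
  by (simp add: is_lengths_def)

lemma is_lengths_nonempty: "is_lengths n l \<Longrightarrow> 1 \<le> n"
  by (cases n) (auto simp: is_lengths_def)

lemma brk_strict_mono:
  assumes "is_lengths n l" "i < j" "j \<le> n"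
  shows "brk l i < brk l j"
  using assms(2,3)
proof (induction j)
  case (Suc j)
  have "brk l j < brk l (Suc j)" using is_lengths_pos[OF assms(1), of "Suc j"] Suc by (simp add: brk_Suc)
  then show ?case using Suc by (cases "i = j") auto
qed simp

lemma brk_mono: "is_lengths n l \<Longrightarrow> i \<le> j \<Longrightarrow> j \<le> n \<Longrightarrow> brk l i \<le> brk l j"
  using brk_strict_mono[of n l i j] by (cases "i = j") auto

lemma brk_less_iff: "is_lengths n l \<Longrightarrow> i \<le> n \<Longrightarrow> j \<le> n \<Longrightarrow> brk l i < brk l j \<longleftrightarrow> i < j"
  using brk_strict_mono[of n l i j] brk_mono[of n l j i] by (meson leD leI)

lemma brk_inj: "is_lengths n l \<Longrightarrow> i \<le> n \<Longrightarrow> j \<le> n \<Longrightarrow> brk l i = brk l j \<Longrightarrow> i = j"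
  using brk_less_iff[of n l] by (metis less_irrefl nat_neq_iff)

lemma brk_in_unit: "is_lengths n l \<Longrightarrow> i \<le> n \<Longrightarrow> brk l i \<in> {0..1}"
  using brk_mono[of n l 0 i] brk_mono[of n l i n] brk_last[of n l] by simp

lemma piece_exists:
  assumes "is_lengths n l" "x \<in> {0..<1}"
  obtains i where "1 \<le> i" "i \<le> n" "brk l (i - 1) \<le> x" "x < brk l i"
proof -
  have n: "x < brk l n" using assms brk_last by auto
  define i where "i = (LEAST i. x < brk l i)"
  have "x < brk l i" "i \<le> n" unfolding i_def using n by (auto intro: LeastI Least_le)
  moreover from this have "i \<noteq> 0" using assms(2) by (metis atLeastLessThan_iff brk_0 leD)
  moreover from this have "\<not> x < brk l (i - 1)" unfolding i_def by (intro not_less_Least) simp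
  ultimately show ?thesis by (intro that) auto
qed

lemma piece_index_eq:
  assumes "is_lengths n l" "1 \<le> i" "i \<le> n" "brk l (i - 1) \<le> x" "x < brk l i"
  shows "piece_index l x = i"
  unfolding piece_index_def
proof (rule Least_equality)
  fix j assume j: "x < brk l j"
  show "i \<le> j"
  proof (rule ccontr)
    assume "\<not> i \<le> j"
    then have "brk l j \<le> brk l (i - 1)" using assms by (intro brk_mono[of n]) auto
    then show False using j assms by simp
  qed
qed fact

lemma piece_in_unit:
  assumes "is_lengths n l" "1 \<le> i" "i \<le> n" "brk l (i - 1) \<le> x" "x < brk l i"
  shows "x \<in> {0..<1}"
proof -
  have "i - 1 \<le> n" using assms(3) by simp
  then show ?thesis using brk_in_unit[OF assms(1), of "i - 1"] brk_in_unit[OF assms(1), of i] assms by auto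
qed

lemma mk_iet_piece:
  assumes "is_lengths n l" "1 \<le> i" "i \<le> n" "brk l (i - 1) \<le> x" "x < brk l i"
  shows "mk_iet n \<sigma> l x = x + shift n \<sigma> l i"
  using piece_index_eq[OF assms] piece_in_unit[OF assms] by (simp add: mk_iet_def)

lemma permutes_mem: "\<sigma> permutes {1..n} \<Longrightarrow> 1 \<le> i \<Longrightarrow> i \<le> n \<Longrightarrow> 1 \<le> \<sigma> i \<and> \<sigma> i \<le> n" for n i :: nat
  using permutes_in_image[of \<sigma> "{1..n}" i] by simp

lemma is_lengths_permute:
  assumes "is_lengths n l" "\<sigma> permutes {1..n}"
  shows "is_lengths n (l \<circ> pinv \<sigma>)"
proof -
  have p: "pinv \<sigma> permutes {1..n}" using assms(2) by (rule permutes_inv)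
  have "(\<Sum>i = 1..n. l i) = (\<Sum>i = 1..n. (l \<circ> pinv \<sigma>) i)" using sum.permute[OF p] .
  then show ?thesis using assms(1) permutes_mem[OF p] by (auto simp: is_lengths_def)
qed

text \<open>Listed from left to right, the images have lengths
  \<open>l \<circ> pinv \<sigma>\<close>, and the image of piece \<open>i\<close> is number
  \<open>\<sigma> i\<close> in this list.\<close>

lemma img_brk_eq_brk:
  assumes "\<sigma> permutes {1..n}" "1 \<le> i" "i \<le> n"
  shows "img_brk n \<sigma> l i = brk (l \<circ> pinv \<sigma>) (\<sigma> i - 1)"
  unfolding img_brk_def brk_def
proof (rule sum.reindex_bij_witness[of _ "pinv \<sigma>" \<sigma>])
  note i = permutes_mem[OF assms(1)] permutes_mem[OF permutes_inv[OF assms(1)]]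
  show "pinv \<sigma> (\<sigma> a) = a" for a using assms(1) by (simp add: permutes_inverses)
  show "\<sigma> (pinv \<sigma> a) = a" for a using assms(1) by (simp add: permutes_inverses)
  show "\<sigma> a \<in> {1..\<sigma> i - 1}" if "a \<in> {j \<in> {1..n}. \<sigma> j < \<sigma> i}" for a
    using that i(1)[of a] by auto
  show "pinv \<sigma> a \<in> {j \<in> {1..n}. \<sigma> j < \<sigma> i}" if "a \<in> {1..\<sigma> i - 1}" for a
    using that i(1)[of i] i(2)[of a] assms by (auto simp: permutes_inverses)
  show "(l \<circ> pinv \<sigma>) (\<sigma> a) = l a" for a using assms(1) by (simp add: permutes_inverses)
qed

lemma mk_iet_image:
  assumes "\<sigma> permutes {1..n}" "is_lengths n l" "1 \<le> i" "i \<le> n" "brk l (i - 1) \<le> x" "x < brk l i"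
  shows "mk_iet n \<sigma> l x = brk (l \<circ> pinv \<sigma>) (\<sigma> i - 1) + (x - brk l (i - 1))"
    and "brk (l \<circ> pinv \<sigma>) (\<sigma> i - 1) \<le> mk_iet n \<sigma> l x" "mk_iet n \<sigma> l x < brk (l \<circ> pinv \<sigma>) (\<sigma> i)"
proof -
  show *: "mk_iet n \<sigma> l x = brk (l \<circ> pinv \<sigma>) (\<sigma> i - 1) + (x - brk l (i - 1))"
    using mk_iet_piece[OF assms(2-)] img_brk_eq_brk[OF assms(1,3,4)] by (simp add: shift_def)
  have "brk (l \<circ> pinv \<sigma>) (\<sigma> i) = brk (l \<circ> pinv \<sigma>) (\<sigma> i - 1) + l i" "brk l i = brk l (i - 1) + l i"
    using permutes_mem[OF assms(1,3,4)] assms brk_step[of "\<sigma> i" "l \<circ> pinv \<sigma>"] brk_step[of i l]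
    by (auto simp: permutes_inverses)
  then show "brk (l \<circ> pinv \<sigma>) (\<sigma> i - 1) \<le> mk_iet n \<sigma> l x" "mk_iet n \<sigma> l x < brk (l \<circ> pinv \<sigma>) (\<sigma> i)"
    using * assms by linarith+
qed

text \<open>Piece \<open>i\<close> is translated onto piece \<open>\<sigma> i\<close> of the
  partition with lengths \<open>l \<circ> pinv \<sigma>\<close>, and the exchange built from the
  inverse data translates it back.\<close>

lemma mk_iet_inverse:
  assumes "\<sigma> permutes {1..n}" "is_lengths n l" "x \<in> {0..<1}"
  shows "mk_iet n \<sigma> l x \<in> {0..<1}"
    and "mk_iet n (pinv \<sigma>) (l \<circ> pinv \<sigma>) (mk_iet n \<sigma> l x) = x"
proof -
  obtain i where i: "1 \<le> i" "i \<le> n" "brk l (i - 1) \<le> x" "x < brk l i"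
    using piece_exists[OF assms(2,3)] .
  note im = mk_iet_image[OF assms(1,2) i]
  have s: "1 \<le> \<sigma> i" "\<sigma> i \<le> n" using permutes_mem[OF assms(1) i(1,2)] by auto
  have l': "is_lengths n (l \<circ> pinv \<sigma>)" using is_lengths_permute assms by blast
  show "mk_iet n \<sigma> l x \<in> {0..<1}" by (rule piece_in_unit[OF l' s im(2,3)])
  have eq: "(l \<circ> pinv \<sigma>) \<circ> pinv (pinv \<sigma>) = l" "pinv \<sigma> (\<sigma> i) = i"
    using assms(1) by (auto simp: permutes_inverses permutes_inv_inv fun_eq_iff)
  have "mk_iet n (pinv \<sigma>) (l \<circ> pinv \<sigma>) (mk_iet n \<sigma> l x) = brk l (i - 1) + (mk_iet n \<sigma> l x - brk (l \<circ> pinv \<sigma>) (\<sigma> i - 1))"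
    using mk_iet_image(1)[OF permutes_inv[OF assms(1)] l' s im(2,3)] eq by simp
  then show "mk_iet n (pinv \<sigma>) (l \<circ> pinv \<sigma>) (mk_iet n \<sigma> l x) = x" using im(1) by simp
qed

lemma mk_iet_inverse':
  assumes "\<sigma> permutes {1..n}" "is_lengths n l" "x \<in> {0..<1}"
  shows "mk_iet n (pinv \<sigma>) (l \<circ> pinv \<sigma>) x \<in> {0..<1}"
    and "mk_iet n \<sigma> l (mk_iet n (pinv \<sigma>) (l \<circ> pinv \<sigma>) x) = x"
proof -
  have eq: "pinv (pinv \<sigma>) = \<sigma>" "(l \<circ> pinv \<sigma>) \<circ> \<sigma> = l"
    using assms(1) by (auto simp: permutes_inverses permutes_inv_inv fun_eq_iff)
  note * = mk_iet_inverse[OF permutes_inv[OF assms(1)] is_lengths_permute[OF assms(2,1)] assms(3)]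
  show "mk_iet n (pinv \<sigma>) (l \<circ> pinv \<sigma>) x \<in> {0..<1}" by (rule *(1))
  show "mk_iet n \<sigma> l (mk_iet n (pinv \<sigma>) (l \<circ> pinv \<sigma>) x) = x" using *(2) unfolding eq .
qed

lemma mk_iet_Bij:
  assumes "\<sigma> permutes {1..n}" "is_lengths n l"
  shows "mk_iet n \<sigma> l \<in> Bij {0..<1}"
proof -
  have "bij_betw (mk_iet n \<sigma> l) {0..<1} {0..<1}"
    using mk_iet_inverse[OF assms] mk_iet_inverse'[OF assms]
    by (intro bij_betw_byWitness[of _ "mk_iet n (pinv \<sigma>) (l \<circ> pinv \<sigma>)"]) blast+
  then show ?thesis by (simp add: Bij_def mk_iet_def)
qed

section \<open>Discontinuities and break points of piecewise translations\<close>

lemma continuous_local_translation: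
  fixes f :: "real \<Rightarrow> real"
  assumes "u < x" "x < v" "x \<in> A" "\<And>y. y \<in> A \<Longrightarrow> u < y \<Longrightarrow> y < v \<Longrightarrow> f y = y + c"
  shows "continuous (at x within A) f"
  unfolding continuous_within_eps_delta
proof (intro allI impI)
  fix e :: real assume "e > 0"
  then show "\<exists>d>0. \<forall>y\<in>A. dist y x < d \<longrightarrow> dist (f y) (f x) < e"
    using assms by (intro exI[of _ "min e (min (x - u) (v - x))"]) (auto simp: dist_real_def)
qed

lemma discontinuous_jump:
  fixes f :: "real \<Rightarrow> real"
  assumes "u < x" "f x = x + c'" "c \<noteq> c'" "{u<..<x} \<subseteq> A" "\<And>y. u < y \<Longrightarrow> y < x \<Longrightarrow> f y = y + c"
  shows "\<not> continuous (at x within A) f"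
proof
  assume "continuous (at x within A) f"
  moreover define e where "e = \<bar>c - c'\<bar> / 2"
  moreover have e: "e > 0" using assms by (simp add: e_def)
  ultimately obtain d where d: "d > 0" "\<And>y. y \<in> A \<Longrightarrow> dist y x < d \<Longrightarrow> dist (f y) (f x) < e"
    unfolding continuous_within_eps_delta by blast
  \<comment> \<open>A step to the left that stays above \<open>u\<close> and within distance
    \<open>d\<close>. Since \<open>h \<le> e\<close>, the two values still differ by at least
    \<open>2 * e - h \<ge> e\<close>.\<close>
  define h where "h = min (d / 2) (min ((x - u) / 2) e)"
  have h: "h > 0" "h < d" "u < x - h" "h \<le> e" using d(1) e assms(1) by (auto simp: h_def min_def field_simps)
  have "dist (f (x - h)) (f x) < e" using h assms(4) by (intro d(2)) (auto simp: dist_real_def)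
  moreover have "f (x - h) = x - h + c" using h by (intro assms(5)) auto
  ultimately show False using h assms(2) by (simp add: dist_real_def e_def abs_if split: if_splits)
qed

lemma iet_disc_piecewise:
  assumes l: "is_lengths n l"
    and f: "\<And>i x. 1 \<le> i \<Longrightarrow> i \<le> n \<Longrightarrow> brk l (i - 1) \<le> x \<Longrightarrow> x < brk l i \<Longrightarrow> f x = x + c i"
    and c: "\<And>i. 1 \<le> i \<Longrightarrow> i < n \<Longrightarrow> c i \<noteq> c (Suc i)"
  shows "iet_disc f = brk l ` {1..<n}"
proof (intro equalityI subsetI)
  fix x assume "x \<in> iet_disc f"
  then have x: "x \<in> {0..<1}" "\<not> continuous (at x within {0..<1}) f" by (auto simp: iet_disc_def)
  obtain i where i: "1 \<le> i" "i \<le> n" "brk l (i - 1) \<le> x" "x < brk l i"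
    using piece_exists[OF l x(1)] .
  \<comment> \<open>The point 0 is no discontinuity: continuity is taken within
    \<open>{0..<1}\<close>, so on the first piece a negative number can serve as the left bound of
    the neighbourhood.\<close>
  have "i \<noteq> 1"
  proof
    assume "i = 1"
    then have "continuous (at x within {0..<1}) f"
      using i x f[of 1] by (intro continuous_local_translation[of "-1" x "brk l i" _ f "c i"]) auto
    then show False using x by simp
  qed
  moreover have "brk l (i - 1) = x"
  proof (rule ccontr)
    assume "brk l (i - 1) \<noteq> x"
    then have "continuous (at x within {0..<1}) f"
      using i x f[of i] by (intro continuous_local_translation[of "brk l (i - 1)" x "brk l i" _ f "c i"]) auto
    then show False using x by simp
  qed
  ultimately show "x \<in> brk l ` {1..<n}" using i by (intro image_eqI[of _ _ "i - 1"]) auto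
next
  fix x assume "x \<in> brk l ` {1..<n}"
  then obtain i where i: "1 \<le> i" "i < n" "x = brk l i" by auto
  have b: "brk l (i - 1) < x" "x < brk l (Suc i)" using i by (auto intro!: brk_strict_mono[OF l])
  have "\<not> continuous (at x within {0..<1}) f"
  proof (rule discontinuous_jump)
    show "f x = x + c (Suc i)" using f[of "Suc i" x] b i by simp
    show "{brk l (i - 1)<..<x} \<subseteq> {0..<1}"
      using piece_in_unit[OF l, of i] i by auto
  qed (use b i c f in auto)
  moreover have "x \<in> {0..<1}" using piece_in_unit[OF l, of "Suc i" x] b i by simp
  ultimately show "x \<in> iet_disc f" by (simp add: iet_disc_def)
qed

lemma iet_breaks_piecewise:
  assumes l: "is_lengths n l" and d: "iet_disc f = brk l ` {1..<n}"
  shows "iet_breaks f = map (brk l) [0..<Suc n]"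
proof -
  have n: "1 \<le> n" using is_lengths_nonempty l .
  have "{0, 1} \<union> iet_disc f = brk l ` ({0, n} \<union> {1..<n})" using d brk_last[OF l] by auto
  also have "{0, n} \<union> {1..<n} = set [0..<Suc n]" using n by auto
  finally have s: "{0, 1} \<union> iet_disc f = set (map (brk l) [0..<Suc n])" by simp
  have "sorted_wrt (<) (map (brk l) [0..<Suc n])"
    unfolding sorted_wrt_map by (rule sorted_wrt_mono_rel[OF _ sorted_wrt_upt])
      (auto intro!: brk_strict_mono[OF l])
  then show ?thesis unfolding iet_breaks_def s
    by (metis sorted_list_of_set.idem_if_sorted_distinct strict_sorted_iff)
qed

lemma card_permutes_less:
  assumes "\<sigma> permutes {1..n}" "1 \<le> i" "i \<le> n"
  shows "Suc (card {j \<in> {1..n}. \<sigma> j < \<sigma> i}) = \<sigma> i"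
proof -
  \<comment> \<open>With all lengths equal to 1, the left end point of an image counts the images to
    its left.\<close>
  have "real (card {j \<in> {1..n}. \<sigma> j < \<sigma> i}) = img_brk n \<sigma> (\<lambda>_. 1) i" by (simp add: img_brk_def)
  also have "\<dots> = real (\<sigma> i - 1)" using img_brk_eq_brk[OF assms, of "\<lambda>_. 1"] by (simp add: brk_def)
  finally show ?thesis using permutes_mem[OF assms] by simp
qed

text \<open>The hypothesis \<open>nc\<close> makes the pieces maximal: equal shifts on two
  neighbouring pieces would make their images adjacent, that is,
  \<open>\<sigma> (Suc i) = Suc (\<sigma> i)\<close>. Hence the break points of the exchange are
  exactly those of \<open>l\<close>, and the data can be read off again.\<close>

theorem mk_iet_IET:
  assumes \<sigma>: "\<sigma> permutes {1..n}" and l: "is_lengths n l"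
    and nc: "\<And>i. 1 \<le> i \<Longrightarrow> i < n \<Longrightarrow> \<sigma> (Suc i) \<noteq> Suc (\<sigma> i)"
  shows "mk_iet n \<sigma> l \<in> IET" "iet_num (mk_iet n \<sigma> l) = n" "iet_perm (mk_iet n \<sigma> l) = \<sigma>"
    and "\<And>i. 1 \<le> i \<Longrightarrow> i \<le> n \<Longrightarrow> iet_length (mk_iet n \<sigma> l) i = l i"
proof -
  let ?f = "mk_iet n \<sigma> l" and ?l' = "l \<circ> pinv \<sigma>"
  have l': "is_lengths n ?l'" using is_lengths_permute[OF l \<sigma>] .
  have c: "shift n \<sigma> l i \<noteq> shift n \<sigma> l (Suc i)" if i: "1 \<le> i" "i < n" for i
  proof
    assume "shift n \<sigma> l i = shift n \<sigma> l (Suc i)"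
    then have "brk ?l' (\<sigma> (Suc i) - 1) = brk ?l' (\<sigma> i - 1) + l i"
      using i \<sigma> img_brk_eq_brk[of \<sigma> n i l] img_brk_eq_brk[of \<sigma> n "Suc i" l] brk_step[of i l]
      by (simp add: shift_def)
    also have "\<dots> = brk ?l' (\<sigma> i)"
      using brk_step[of "\<sigma> i" ?l'] permutes_mem[OF \<sigma>, of i] i \<sigma> by (simp add: permutes_inverses)
    finally have "\<sigma> (Suc i) - 1 = \<sigma> i"
      using permutes_mem[OF \<sigma>, of i] permutes_mem[OF \<sigma>, of "Suc i"] i by (intro brk_inj[OF l']) auto
    moreover have "1 \<le> \<sigma> (Suc i)" using permutes_mem[OF \<sigma>, of "Suc i"] i by simp
    ultimately show False using nc[OF i] by linarith
  qed
  have disc: "iet_disc ?f = brk l ` {1..<n}"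
    using l mk_iet_piece[OF l] c by (rule iet_disc_piecewise) auto
  have br: "iet_breaks ?f = map (brk l) [0..<Suc n]" by (rule iet_breaks_piecewise[OF l disc])
  show num: "iet_num ?f = n" by (simp add: iet_num_def br)
  have nth: "iet_breaks ?f ! i = brk l i" if "i \<le> n" for i
    unfolding br using that by (subst nth_map) (auto simp del: upt_Suc)
  have pc: "iet_piece ?f i = {brk l (i - 1)..<brk l i}" if "1 \<le> i" "i \<le> n" for i
    using that by (simp add: iet_piece_def nth)
  show "iet_length ?f i = l i" if "1 \<le> i" "i \<le> n" for i
    using that nth brk_step[of i l] by (simp add: iet_length_def)
  have right: "continuous (at_right x) ?f" if x: "x \<in> {0..<1}" for x
  proof -
    obtain i where i: "1 \<le> i" "i \<le> n" "brk l (i - 1) \<le> x" "x < brk l i"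
      using piece_exists[OF l x] .
    have "continuous (at x within {x..}) ?f"
      using i mk_iet_piece[OF l, of i]
      by (intro continuous_local_translation[of "x - 1" x "brk l i" _ _ "shift n \<sigma> l i"]) auto
    then show ?thesis by (rule continuous_within_subset) auto
  qed
  show "?f \<in> IET"
    unfolding IET_def mem_Collect_eq num
    using mk_iet_Bij[OF \<sigma> l] right disc mk_iet_piece[OF l] pc by force
  show "iet_perm ?f = \<sigma>"
  proof
    fix i
    show "iet_perm ?f i = \<sigma> i"
    proof (cases "i \<in> {1..n}")
      case False
      then show ?thesis using permutes_not_in[OF \<sigma> False] by (simp only: iet_perm_def num if_False)
    next
      case i: True
      have "(\<forall>y\<in>?f ` iet_piece ?f j. \<forall>z\<in>?f ` iet_piece ?f i. y < z) \<longleftrightarrow> \<sigma> j < \<sigma> i"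
        if j: "j \<in> {1..n}" for j
      proof
        assume lt: "\<sigma> j < \<sigma> i"
        then have "brk ?l' (\<sigma> j) \<le> brk ?l' (\<sigma> i - 1)"
          using permutes_mem[OF \<sigma>, of i] i by (intro brk_mono[OF l']) auto
        then show "\<forall>y\<in>?f ` iet_piece ?f j. \<forall>z\<in>?f ` iet_piece ?f i. y < z"
          using mk_iet_image(2)[OF \<sigma> l, of i] mk_iet_image(3)[OF \<sigma> l, of j] i j pc by force
      next
        assume all: "\<forall>y\<in>?f ` iet_piece ?f j. \<forall>z\<in>?f ` iet_piece ?f i. y < z"
        have lt: "brk l (k - 1) < brk l k" if "k \<in> {1..n}" for k
          using that by (intro brk_strict_mono[OF l]) auto
        have "?f (brk l (k - 1)) = brk ?l' (\<sigma> k - 1)" if "k \<in> {1..n}" for k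
          using mk_iet_image(1)[OF \<sigma> l, of k "brk l (k - 1)"] lt that by simp
        moreover have "brk l (k - 1) \<in> iet_piece ?f k" if "k \<in> {1..n}" for k
          using lt that pc by simp
        ultimately have "brk ?l' (\<sigma> j - 1) < brk ?l' (\<sigma> i - 1)" using all i j by (metis imageI)
        then have "\<sigma> j - 1 < \<sigma> i - 1"
          using brk_less_iff[OF l', of "\<sigma> j - 1" "\<sigma> i - 1"] permutes_mem[OF \<sigma>, of i] permutes_mem[OF \<sigma>, of j] i j
          by (simp add: le_diff_conv)
        then show "\<sigma> j < \<sigma> i" by simp
      qed
      then have "{j \<in> {1..n}. \<forall>y\<in>?f ` iet_piece ?f j. \<forall>z\<in>?f ` iet_piece ?f i. y < z} =
          {j \<in> {1..n}. \<sigma> j < \<sigma> i}" by blast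
      then show ?thesis using i card_permutes_less[OF \<sigma>, of i] by (simp add: iet_perm_def num)
    qed
  qed
qed

section \<open>Every exchange comes from a permutation and lengths\<close>

lemma rank_permutes:
  fixes q :: "nat \<Rightarrow> real"
  assumes "inj_on q {1..n}"
  defines "r \<equiv> \<lambda>i. if i \<in> {1..n} then Suc (card {j \<in> {1..n}. q j < q i}) else i"
  shows "r permutes {1..n}" "\<And>i j. i \<in> {1..n} \<Longrightarrow> j \<in> {1..n} \<Longrightarrow> r j < r i \<longleftrightarrow> q j < q i"
proof -
  have mono: "r j < r i" if "i \<in> {1..n}" "j \<in> {1..n}" "q j < q i" for i j
  proof -
    have "{k \<in> {1..n}. q k < q j} \<subset> {k \<in> {1..n}. q k < q i}" using that by auto
    then have "card {k \<in> {1..n}. q k < q j} < card {k \<in> {1..n}. q k < q i}"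
      by (intro psubset_card_mono) auto
    then show ?thesis using that by (simp add: r_def)
  qed
  show iff: "r j < r i \<longleftrightarrow> q j < q i" if "i \<in> {1..n}" "j \<in> {1..n}" for i j
  proof (cases "q j < q i")
    case False
    then have "j = i \<or> q i < q j" using that assms(1) by (metis inj_onD linorder_less_linear)
    then show ?thesis using False mono[of j i] that by auto
  qed (use mono that in auto)
  have inj: "inj_on r {1..n}"
    using assms(1) iff by (intro inj_onI) (metis inj_onD linorder_less_linear less_irrefl)
  have "r i \<in> {1..n}" if "i \<in> {1..n}" for i
  proof -
    have "card {j \<in> {1..n}. q j < q i} \<le> card ({1..n} - {i})" by (rule card_mono) auto
    moreover have "card ({1..n} - {i}) = n - 1" using that by simp
    moreover have "1 \<le> n" using that by simp
    ultimately have "Suc (card {j \<in> {1..n}. q j < q i}) \<le> n" by linarith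
    then show ?thesis using that by (simp add: r_def)
  qed
  then have "r ` {1..n} = {1..n}" by (intro endo_inj_surj inj) auto
  then have "bij_betw r {1..n} {1..n}" using inj by (simp add: bij_betw_def)
  then show "r permutes {1..n}" by (rule bij_imp_permutes) (simp add: r_def del: atLeastAtMost_iff)
qed

text \<open>The converse of \<open>mk_iet_IET\<close>. The images of the pieces are disjoint
  intervals that tile \<open>[0,1)\<close>, so the left end of each is the total length of the
  images before it. This determines the translation on each piece from \<open>\<sigma>\<close> and
  \<open>l\<close>.\<close>

lemma IET_structure:
  assumes f: "f \<in> IET"
  defines "n \<equiv> iet_num f" and "\<sigma> \<equiv> iet_perm f" and "l \<equiv> iet_length f"
  shows "\<sigma> permutes {1..n}" "is_lengths n l" "f = mk_iet n \<sigma> l"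
    and "\<And>i. 1 \<le> i \<Longrightarrow> i < n \<Longrightarrow> \<sigma> (Suc i) \<noteq> Suc (\<sigma> i)"
proof -
  let ?b = "iet_breaks f"
  have fin: "finite (iet_disc f)" and Bij: "f \<in> Bij {0..<1}" using f by (auto simp: IET_def)
  have set_b: "set ?b = {0, 1} \<union> iet_disc f" unfolding iet_breaks_def using fin by (subst set_sorted_list_of_set) auto
  have sorted: "sorted_wrt (<) ?b" unfolding iet_breaks_def by simp
  have unit: "set ?b \<subseteq> {0..1}" using set_b by (auto simp: iet_disc_def)
  have "card {0, 1 :: real} \<le> card (set ?b)" by (rule card_mono) (auto simp: set_b fin)
  then have "2 \<le> length ?b" using card_length[of ?b] by simp
  then have n: "1 \<le> n" and len: "length ?b = Suc n" by (auto simp: n_def iet_num_def)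
  have lt: "?b ! i < ?b ! j" if "i < j" "j \<le> n" for i j
    using sorted_wrt_nth_less[OF sorted, of i j] that len by simp
  have ex: "\<exists>i\<le>n. ?b ! i = x" if "x \<in> set ?b" for x
    using that len by (metis in_set_conv_nth less_Suc_eq_le)
  have mem: "?b ! i \<in> {0..1}" if "i \<le> n" for i
    using that len unit nth_mem[of i ?b] by fastforce
  have b0: "?b ! 0 = 0"
  proof -
    obtain i where "i \<le> n" "?b ! i = 0" using ex[of 0] set_b by auto
    then show ?thesis using lt[of 0 i] mem[of 0] by (cases "i = 0") auto
  qed
  have bn: "?b ! n = 1"
  proof -
    obtain i where "i \<le> n" "?b ! i = 1" using ex[of 1] set_b by auto
    then show ?thesis using lt[of i n] mem[of n] by (cases "i = n") auto
  qed
  have brk: "brk l i = ?b ! i" for i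
    by (induction i) (simp_all add: b0 brk_Suc l_def iet_length_def)
  show l: "is_lengths n l"
    using brk[of n] bn lt by (auto simp: is_lengths_def brk_def l_def iet_length_def)
  have pc: "iet_piece f i = {brk l (i - 1)..<brk l i}" for i by (simp add: iet_piece_def brk)
  obtain c where c: "\<And>i x. 1 \<le> i \<Longrightarrow> i \<le> n \<Longrightarrow> brk l (i - 1) \<le> x \<Longrightarrow> x < brk l i \<Longrightarrow> f x = x + c i"
  proof -
    have "\<forall>i\<in>{1..n}. \<exists>c. \<forall>x\<in>iet_piece f i. f x = x + c" using f by (simp add: IET_def n_def)
    then obtain c where "\<And>i. i\<in>{1..n} \<Longrightarrow> \<forall>x\<in>iet_piece f i. f x = x + c i" by metis
    then show ?thesis using that by (simp add: pc)
  qed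
  have inj: "inj_on f {0..<1}" and img: "f ` {0..<1} = {0..<1}"
    using Bij by (auto simp: Bij_def bij_betw_def)
  \<comment> \<open>The left end point of the image of piece \<open>i\<close>. Comparing these
    numbers replaces the comparison of whole images in \<open>iet_perm\<close>.\<close>
  define q where "q i = brk l (i - 1) + c i" for i
  have step: "brk l i = brk l (i - 1) + l i" if "1 \<le> i" for i using brk_step that .
  have fpc: "f ` iet_piece f i = {q i..<q i + l i}" if i: "1 \<le> i" "i \<le> n" for i
  proof -
    have "f ` iet_piece f i = (\<lambda>x. x + c i) ` {brk l (i - 1)..<brk l i}"
      unfolding pc using c[OF i] by (intro image_cong) auto
    also have "\<dots> = {brk l (i - 1) + c i..<brk l i + c i}" by simp
    finally show ?thesis using step[OF i(1)] by (simp add: q_def add_ac)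
  qed
  have psub: "iet_piece f i \<subseteq> {0..<1}" if "1 \<le> i" "i \<le> n" for i
    unfolding pc by (intro subsetI piece_in_unit[OF l that]) auto
  have disj: "f ` iet_piece f i \<inter> f ` iet_piece f j = {}"
    if "1 \<le> i" "i \<le> n" "1 \<le> j" "j \<le> n" "i \<noteq> j" for i j
  proof -
    have "iet_piece f i \<inter> iet_piece f j = {}"
      using piece_index_eq[OF l that(1,2)] piece_index_eq[OF l that(3,4)] that(5) unfolding pc
      by (metis atLeastLessThan_iff disjoint_iff)
    then show ?thesis using inj_on_image_Int[OF inj psub psub, of i j] that by auto
  qed
  have sep: "q j + l j \<le> q i" if ij: "i \<in> {1..n}" "j \<in> {1..n}" "i \<noteq> j" "q j \<le> q i" for i j
  proof (rule ccontr)
    assume "\<not> q j + l j \<le> q i"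
    then have "q i \<in> f ` iet_piece f j" "q i \<in> f ` iet_piece f i"
      using fpc ij is_lengths_pos[OF l, of i] by auto
    then show False using disj[of i j] ij by auto
  qed
  have qinj: "inj_on q {1..n}"
  proof (rule inj_onI, rule ccontr)
    fix i j assume ij: "i \<in> {1..n}" "j \<in> {1..n}" "q i = q j" "i \<noteq> j"
    show False using sep[of i j] is_lengths_pos[OF l, of j] ij by auto
  qed
  have left: "(\<forall>y\<in>f ` iet_piece f j. \<forall>z\<in>f ` iet_piece f i. y < z) \<longleftrightarrow> q j < q i"
    if ij: "i \<in> {1..n}" "j \<in> {1..n}" for i j
  proof
    assume all: "\<forall>y\<in>f ` iet_piece f j. \<forall>z\<in>f ` iet_piece f i. y < z"
    have "q j \<in> f ` iet_piece f j" "q i \<in> f ` iet_piece f i"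
      using fpc[of i] fpc[of j] ij is_lengths_pos[OF l, of i] is_lengths_pos[OF l, of j] by auto
    then show "q j < q i" by (rule bspec[OF bspec[OF all]])
  next
    assume "q j < q i"
    moreover from this have "q j + l j \<le> q i" using sep[of i j] ij by (cases "i = j") auto
    ultimately show "\<forall>y\<in>f ` iet_piece f j. \<forall>z\<in>f ` iet_piece f i. y < z"
      using fpc[of i] fpc[of j] ij by auto
  qed
  have \<sigma>: "\<sigma> = (\<lambda>i. if i \<in> {1..n} then Suc (card {j \<in> {1..n}. q j < q i}) else i)"
  proof
    fix i
    have "{j \<in> {1..n}. \<forall>y\<in>f ` iet_piece f j. \<forall>z\<in>f ` iet_piece f i. y < z} = {j \<in> {1..n}. q j < q i}"
      if "i \<in> {1..n}" using left[OF that] by blast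
    then show "\<sigma> i = (if i \<in> {1..n} then Suc (card {j \<in> {1..n}. q j < q i}) else i)"
      by (simp add: \<sigma>_def iet_perm_def n_def)
  qed
  show perm: "\<sigma> permutes {1..n}" unfolding \<sigma> by (rule rank_permutes(1)[OF qinj])
  have ord: "\<sigma> j < \<sigma> i \<longleftrightarrow> q j < q i" if "i \<in> {1..n}" "j \<in> {1..n}" for i j
    unfolding \<sigma> using rank_permutes(2)[OF qinj that] .
  have q: "q i = img_brk n \<sigma> l i" if i: "i \<in> {1..n}" for i
  proof -
    let ?J = "{j \<in> {1..n}. \<sigma> j < \<sigma> i}"
    have unit_img: "{q j..<q j + l j} \<subseteq> {0..<1}" if "j \<in> {1..n}" for j
      using fpc[of j] image_mono[OF psub, of j f] that unfolding img by simp
    have "q i \<in> {0..<1}" using unit_img[OF i] is_lengths_pos[OF l, of i] i by (intro subsetD[OF unit_img[OF i]]) simp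
    then have q0: "0 \<le> q i" "q i < 1" by auto
    have cover: "(\<Union>j\<in>?J. {q j..<q j + l j}) = {0..<q i}"
    proof (intro equalityI subsetI)
      fix y assume "y \<in> (\<Union>j\<in>?J. {q j..<q j + l j})"
      then obtain j where j: "j \<in> {1..n}" "q j < q i" "y \<in> {q j..<q j + l j}" using ord[OF i] by auto
      moreover have "q j + l j \<le> q i" using sep[of i j] i j by (cases "i = j") auto
      moreover have "y \<in> {0..<1}" using unit_img[OF j(1)] j(3) by blast
      ultimately show "y \<in> {0..<q i}" by auto
    next
      fix y assume y: "y \<in> {0..<q i}"
      then have "y \<in> f ` {0..<1}" using img q0 by auto
      then obtain x where x: "x \<in> {0..<1}" "y = f x" by blast
      obtain j where j: "1 \<le> j" "j \<le> n" "brk l (j - 1) \<le> x" "x < brk l j" using piece_exists[OF l x(1)] .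
      have yj: "y \<in> {q j..<q j + l j}" using fpc[of j] j x pc by auto
      then have "q j < q i" using y by auto
      then show "y \<in> (\<Union>j\<in>?J. {q j..<q j + l j})" using ord[OF i, of j] j yj by auto
    qed
    \<comment> \<open>Lebesgue measure turns the disjoint cover of \<open>{0..<q i}\<close> into the
      sum of lengths that defines \<open>img_brk\<close>.\<close>
    have "measure lborel (\<Union>j\<in>?J. {q j..<q j + l j}) = (\<Sum>j\<in>?J. measure lborel {q j..<q j + l j})"
    proof (rule measure_finite_Union)
      show "disjoint_family_on (\<lambda>j. {q j..<q j + l j}) ?J"
        unfolding disjoint_family_on_def using disj fpc by auto
    qed (use is_lengths_pos[OF l] in \<open>auto simp: less_imp_le\<close>)
    also have "\<dots> = (\<Sum>j\<in>?J. l j)"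
      using is_lengths_pos[OF l] by (intro sum.cong) (auto simp: less_imp_le)
    finally show ?thesis using q0 unfolding cover by (simp add: img_brk_def)
  qed
  have cs: "c i = shift n \<sigma> l i" if "i \<in> {1..n}" for i
    using q[OF that] by (simp add: q_def shift_def)
  show "f = mk_iet n \<sigma> l"
  proof
    fix x
    show "f x = mk_iet n \<sigma> l x"
    proof (cases "x \<in> {0..<1}")
      case True
      obtain i where i: "1 \<le> i" "i \<le> n" "brk l (i - 1) \<le> x" "x < brk l i" using piece_exists[OF l True] .
      then show ?thesis using mk_iet_piece[OF l i] c[OF i] cs[of i] by simp
    next
      case False
      moreover have "f \<in> extensional {0..<1}" using Bij by (simp add: Bij_def)
      ultimately show ?thesis by (simp add: mk_iet_def extensional_def del: atLeastLessThan_iff)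
    qed
  qed
  \<comment> \<open>Otherwise both neighbouring pieces would be translated by the same amount and
    \<open>f\<close> would be continuous at the break point between them.\<close>
  show "\<sigma> (Suc i) \<noteq> Suc (\<sigma> i)" if i: "1 \<le> i" "i < n" for i
  proof
    assume eq: "\<sigma> (Suc i) = Suc (\<sigma> i)"
    have "{j \<in> {1..n}. \<sigma> j < \<sigma> (Suc i)} = insert i {j \<in> {1..n}. \<sigma> j < \<sigma> i}"
      using i permutes_inj[OF perm] unfolding eq by (auto simp: less_Suc_eq inj_def)
    then have "img_brk n \<sigma> l (Suc i) = img_brk n \<sigma> l i + l i" by (simp add: img_brk_def)
    then have ceq: "c (Suc i) = c i" using cs i step[of i] by (simp add: shift_def)
    let ?x = "brk l i"
    have bl: "brk l (i - 1) < ?x" "?x < brk l (Suc i)" using i by (auto intro!: brk_strict_mono[OF l])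
    have xu: "?x \<in> {0..<1}" using piece_in_unit[OF l, of "Suc i" ?x] bl i by simp
    have "f y = y + c i" if "brk l (i - 1) < y" "y < brk l (Suc i)" for y
      using c[of i y] c[of "Suc i" y] ceq i that by (cases "y < ?x") auto
    then have cont: "continuous (at ?x within {0..<1}) f"
      using bl xu by (intro continuous_local_translation[of "brk l (i - 1)" _ "brk l (Suc i)"]) auto
    have "?x \<in> set ?b" using brk i len by simp
    moreover have "?x \<noteq> 0" using brk_strict_mono[OF l, of 0 i] i by simp
    ultimately have "?x \<in> iet_disc f" using set_b xu by auto
    then show False using cont by (simp add: iet_disc_def)
  qed
qed

lemma IET_inverse:
  assumes "S \<in> IET"
  shows "\<exists>R\<in>IET. \<forall>x\<in>{0..<1}. S x \<in> {0..<1} \<and> R x \<in> {0..<1} \<and> R (S x) = x \<and> S (R x) = x"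
proof -
  define n \<sigma> l where "n = iet_num S" and "\<sigma> = iet_perm S" and "l = iet_length S"
  note st = IET_structure[OF assms, folded n_def \<sigma>_def l_def]
  let ?R = "mk_iet n (pinv \<sigma>) (l \<circ> pinv \<sigma>)"
  have "?R \<in> IET"
  proof (rule mk_iet_IET)
    fix k assume k: "1 \<le> k" "k < n"
    show "pinv \<sigma> (Suc k) \<noteq> Suc (pinv \<sigma> k)"
    proof
      assume eq: "pinv \<sigma> (Suc k) = Suc (pinv \<sigma> k)"
      then have "\<sigma> (Suc (pinv \<sigma> k)) = Suc (\<sigma> (pinv \<sigma> k))"
        by (metis permutes_inverses(1)[OF st(1)])
      moreover have "1 \<le> pinv \<sigma> k" "Suc (pinv \<sigma> k) \<le> n"
        using permutes_mem[OF permutes_inv[OF st(1)], of k] permutes_mem[OF permutes_inv[OF st(1)], of "Suc k"] k eq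
        by auto
      ultimately show False using st(4)[of "pinv \<sigma> k"] by simp
    qed
  qed (use st permutes_inv is_lengths_permute in auto)
  moreover have "\<forall>x\<in>{0..<1}. S x \<in> {0..<1} \<and> ?R x \<in> {0..<1} \<and> ?R (S x) = x \<and> S (?R x) = x"
    using mk_iet_inverse[OF st(1,2), folded st(3)] mk_iet_inverse'[OF st(1,2), folded st(3)] by blast
  ultimately show ?thesis by blast
qed

section \<open>Drift\<close>

text \<open>By the pigeonhole principle the orbit of \<open>x\<close> repeats within
  \<open>card A\<close> steps, and injectivity moves the repetition back to \<open>x\<close>. The
  period is at most \<open>card A\<close>, so it divides the factorial.\<close>

lemma funpow_fact_card:
  assumes "finite A" "f ` A \<subseteq> A" "inj_on f A" "x \<in> A"
  shows "(f ^^ fact (card A)) x = x"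
proof -
  have mem: "(f ^^ i) x \<in> A" for i using assms(2,4) by (induction i) auto
  have cancel: "y = x" if "(f ^^ i) y = (f ^^ i) x" "y \<in> A" for i y
    using that
  proof (induction i)
    case (Suc i)
    have "(f ^^ i) y \<in> A" using Suc.prems(2) assms(2) by (induction i) auto
    then show ?case using Suc assms(3) mem[of i] by (auto dest: inj_onD)
  qed simp
  have "\<not> inj_on (\<lambda>i. (f ^^ i) x) {0..card A}"
  proof
    assume "inj_on (\<lambda>i. (f ^^ i) x) {0..card A}"
    then have "card {0..card A} \<le> card A" by (rule card_inj_on_le) (use mem assms(1) in auto)
    then show False by simp
  qed
  then obtain i k where ik: "i < k" "k \<le> card A" "(f ^^ k) x = (f ^^ i) x"
    unfolding inj_on_def by (metis atLeastAtMost_iff linorder_neqE_nat)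
  define e where "e = k - i"
  have e: "e > 0" "e \<le> card A" "k = i + e" using ik by (auto simp: e_def)
  have "(f ^^ i) ((f ^^ e) x) = (f ^^ i) x" using ik(3) e(3) by (simp add: funpow_add)
  then have "(f ^^ e) x = x" using cancel mem by blast
  then have "((f ^^ e) ^^ k) x = x" for k by (induction k) auto
  moreover have "e dvd fact (card A)" using e by (simp add: dvd_fact)
  ultimately show ?thesis by (metis dvdE funpow_mult)
qed

text \<open>On each of the \<open>N\<close> cells of width \<open>h\<close>, shrunk by
  \<open>\<kappa>\<close>, the map \<open>T\<close> translates by a multiple of \<open>h\<close>
  plus an error of at most \<open>\<beta>\<close>. The multiples of \<open>h\<close> permute the
  cells, and \<open>N!\<close> iterations undo this permutation. Only the sum of the errors remains,
  at most \<open>p * \<beta>\<close>, and the cells are shrunk further by this amount to contain the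
  orbit.\<close>

lemma power_near_identity:
  fixes T :: "real \<Rightarrow> real" and N p :: nat and h \<kappa> \<beta> :: real
  defines "h \<equiv> 1 / real N" and "p \<equiv> fact N"
  assumes N: "0 < N" and \<kappa>: "0 \<le> \<kappa>" and \<beta>: "0 \<le> \<beta>" and small: "\<kappa> + \<beta> < h / 2"
    and T: "\<And>x. x \<in> {0..<1} \<Longrightarrow> T x \<in> {0..<1}" and inj: "inj_on T {0..<1}"
    and drift: "\<And>x. x \<in> {0..<1} \<Longrightarrow> \<exists>k::int. \<exists>\<epsilon>. 0 \<le> \<epsilon> \<and> \<epsilon> \<le> \<beta> \<and> T x = x + k * h + \<epsilon>"
    and loc: "\<And>j x y. j < N \<Longrightarrow> real j * h + \<kappa> \<le> x \<Longrightarrow> x < (real j + 1) * h - \<kappa> \<Longrightarrow>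
       real j * h + \<kappa> \<le> y \<Longrightarrow> y < (real j + 1) * h - \<kappa> \<Longrightarrow> T y - y = T x - x"
  shows "\<exists>d. \<forall>j<N. 0 \<le> d j \<and> d j \<le> p * \<beta> \<and>
    (\<forall>x. real j * h + (\<kappa> + p * \<beta>) \<le> x \<longrightarrow> x < (real j + 1) * h - (\<kappa> + p * \<beta>) \<longrightarrow> (T ^^ p) x = x + d j)"
proof -
  have h: "h > 0" "real N * h = 1" using N by (simp_all add: h_def)
  \<comment> \<open>Cell midpoints. By \<open>\<kappa> + \<beta> < h / 2\<close> they and all points
    up to \<open>\<beta>\<close> to their right lie where \<open>T\<close> is a translation.\<close>
  define X where "X j = (real j + 1 / 2) * h" for j
  have Xu: "X j \<in> {0..<1}" if "j < N" for j
  proof -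
    have "X j < real N * h" unfolding X_def using that h by (intro mult_strict_right_mono) auto
    then show ?thesis using h by (simp add: X_def)
  qed
  have "\<exists>k::int. \<exists>\<epsilon>. 0 \<le> \<epsilon> \<and> \<epsilon> \<le> \<beta> \<and> T (X j) = X j + k * h + \<epsilon>" if "j < N" for j
    using drift[OF Xu[OF that]] .
  then obtain k :: "nat \<Rightarrow> int" and \<epsilon> where ke: "\<And>j. j < N \<Longrightarrow> 0 \<le> \<epsilon> j \<and> \<epsilon> j \<le> \<beta> \<and> T (X j) = X j + k j * h + \<epsilon> j"
    by metis
  have Tj: "T x = x + k j * h + \<epsilon> j"
    if "j < N" "real j * h + \<kappa> \<le> x" "x < (real j + 1) * h - \<kappa>" for j x
  proof -
    have "T x - x = T (X j) - X j"
      using that small \<beta> by (intro loc[of j]) (auto simp: X_def algebra_simps)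
    then show ?thesis using ke[OF that(1)] by simp
  qed
  have rng: "0 \<le> int j + k j \<and> int j + k j < int N" if j: "j < N" for j
  proof -
    have TX: "T (X j) = (int j + k j + 1 / 2) * h + \<epsilon> j" using ke[OF j] by (simp add: X_def algebra_simps)
    have "0 \<le> T (X j)" "T (X j) < 1" using T[OF Xu[OF j]] by auto
    then have "(- 1) * h < (int j + k j) * h" "(int j + k j) * h < real N * h"
      using TX ke[OF j] small \<kappa> h by (auto simp: algebra_simps)
    then have "- 1 < real_of_int (int j + k j)" "real_of_int (int j + k j) < real N"
      using h(1) mult_less_cancel_right_pos by blast+
    then show ?thesis by linarith
  qed
  define \<rho> where "\<rho> j = nat (int j + k j)" for j
  have \<rho>: "\<rho> j < N" "real (\<rho> j) = real j + k j" if "j < N" for j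
    using rng[OF that] by (auto simp: \<rho>_def)
  have TX: "T (X j) = X (\<rho> j) + \<epsilon> j" if "j < N" for j
    using ke[OF that] \<rho>[OF that] by (simp add: X_def algebra_simps)
  \<comment> \<open>If the midpoints of cells \<open>i\<close> and \<open>j\<close> land in the same
    cell, moving \<open>X j\<close> by the difference of their errors gives a point \<open>y\<close>
    of cell \<open>j\<close> with the same image as \<open>X i\<close>. Injectivity of
    \<open>T\<close> gives \<open>y = X i\<close>, so \<open>i\<close> and \<open>j\<close> differ
    by less than 1.\<close>
  have inj\<rho>': "i = j" if ij: "i < N" "j < N" "\<rho> i = \<rho> j" "\<epsilon> j \<le> \<epsilon> i" for i j
  proof -
    define y where "y = X j + (\<epsilon> i - \<epsilon> j)"
    have yb: "real j * h + \<kappa> \<le> y" "y < (real j + 1) * h - \<kappa>"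
      using ke[OF ij(1)] ke[OF ij(2)] ij(4) small \<beta> by (auto simp: y_def X_def algebra_simps)
    have "T y = T (X i)" using Tj[OF ij(2) yb] TX[OF ij(1)] ij(3) \<rho>[OF ij(2)] by (simp add: y_def X_def algebra_simps)
    moreover have "(real j + 1) * h \<le> real N * h" using ij(2) h(1) by (intro mult_right_mono) auto
    then have "y \<in> {0..<1}" using yb h \<kappa> by (auto intro: order_trans[of _ "real j * h + \<kappa>"])
    ultimately have "y = X i" using inj Xu[OF ij(1)] by (auto dest: inj_onD)
    then have eq: "(real i - real j) * h = \<epsilon> i - \<epsilon> j" by (simp add: y_def X_def algebra_simps)
    have "(- 1) * h < (real i - real j) * h" "(real i - real j) * h < 1 * h"
      unfolding eq using ke[OF ij(1)] ke[OF ij(2)] ij(4) small \<kappa> h(1) by linarith+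
    then have "- 1 < real i - real j" "real i - real j < 1" using h(1) mult_less_cancel_right_pos by blast+
    then have "real i < real (Suc j)" "real j < real (Suc i)" by simp_all
    then have "i < Suc j" "j < Suc i" by (simp_all only: of_nat_less_iff)
    then show ?thesis by simp
  qed
  have inj\<rho>: "inj_on \<rho> {..<N}"
  proof (rule inj_onI)
    fix i j assume "i \<in> {..<N}" "j \<in> {..<N}" "\<rho> i = \<rho> j"
    then show "i = j" using inj\<rho>'[of i j] inj\<rho>'[of j i] by (cases "\<epsilon> j \<le> \<epsilon> i") auto
  qed
  have cyc: "(\<rho> ^^ p) j = j" if "j < N" for j
  proof -
    have "\<rho> ` {..<N} \<subseteq> {..<N}" using \<rho>(1) by blast
    then show ?thesis using funpow_fact_card[OF finite_lessThan _ inj\<rho>, of j] that by (simp add: p_def)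
  qed
  have orb: "(\<rho> ^^ i) j < N" if "j < N" for i j using that \<rho> by (induction i) auto
  \<comment> \<open>The total error of the first \<open>i\<close> steps from cell
    \<open>j\<close>.\<close>
  define e where "e i j = (\<Sum>l<i. \<epsilon> ((\<rho> ^^ l) j))" for i j
  have e: "0 \<le> e i j \<and> e i j \<le> real i * \<beta>" if "j < N" for i j
  proof (induction i)
    case (Suc i)
    then show ?case using ke[OF orb[OF that, of i]] by (simp add: e_def algebra_simps)
  qed (simp add: e_def)
  \<comment> \<open>Errors push to the right, so the room \<open>p * \<beta>\<close> is reserved at
    the right end of the cell.\<close>
  have iter: "(T ^^ i) x = x + (real ((\<rho> ^^ i) j) - real j) * h + e i j"
    if j: "j < N" and x: "real j * h + \<kappa> \<le> x" "x < (real j + 1) * h - \<kappa> - p * \<beta>" and "i \<le> p" for i j x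
    using \<open>i \<le> p\<close>
  proof (induction i)
    case (Suc i)
    let ?j = "(\<rho> ^^ i) j" and ?x = "(T ^^ i) x"
    have IH: "?x = x + (real ?j - real j) * h + e i j" using Suc by simp
    have "real i * \<beta> \<le> p * \<beta>" using Suc.prems \<beta> by (intro mult_right_mono) auto
    then have "e i j \<le> p * \<beta>" using e[OF j, of i] by simp
    then have "T ?x = ?x + k ?j * h + \<epsilon> ?j"
      using x e[OF j, of i] IH by (intro Tj orb[OF j]) (auto simp: algebra_simps)
    then have "(T ^^ Suc i) x = ?x + k ?j * h + \<epsilon> ?j" by simp
    also have "\<dots> = x + (real ((\<rho> ^^ Suc i) j) - real j) * h + e (Suc i) j"
      unfolding IH using \<rho>(2)[OF orb[OF j, of i]] by (simp add: e_def algebra_simps)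
    finally show ?case .
  qed (simp add: e_def)
  show ?thesis
  proof (intro exI[of _ "e p"] allI impI conjI)
    fix j x assume j: "j < N"
    show "0 \<le> e p j" "e p j \<le> p * \<beta>" using e[OF j, of p] by auto
    assume x: "real j * h + (\<kappa> + p * \<beta>) \<le> x" "x < (real j + 1) * h - (\<kappa> + p * \<beta>)"
    have "0 \<le> p * \<beta>" using \<beta> by (simp add: p_def)
    then show "(T ^^ p) x = x + e p j" using iter[OF j, of x p] x cyc[OF j] by simp
  qed
qed

text \<open>
  Away from \<open>F\<close> both \<open>A\<close> and \<open>S \<circ> A \<circ> S\<^sup>-\<^sup>1\<close> act as small translations, so they commute there.
\<close>

lemma conjugate_commutes_off_finite:
  fixes A S R :: "real \<Rightarrow> real" and N :: nat and h :: real and d :: "nat \<Rightarrow> real"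
  defines "h \<equiv> 1 / real N"
  assumes N: "0 < N" and \<eta>: "0 < \<eta>"
    and d: "\<And>j. j < N \<Longrightarrow> 0 \<le> d j \<and> d j \<le> \<eta>"
    and A: "\<And>j x. j < N \<Longrightarrow> real j * h + \<eta> \<le> x \<Longrightarrow> x < (real j + 1) * h - \<eta> \<Longrightarrow> A x = x + d j"
    and SR: "\<And>x. x \<in> {0..<1} \<Longrightarrow> S x \<in> {0..<1} \<and> R x \<in> {0..<1} \<and> R (S x) = x \<and> S (R x) = x"
    and F: "1 \<in> F" "\<And>j. j < N \<Longrightarrow> real j * h \<in> F" "\<And>j. j < N \<Longrightarrow> S (real j * h) \<in> F"
    and R: "\<And>y z. y \<in> {0..<1} \<Longrightarrow> z \<in> {0..<1} \<Longrightarrow> y \<le> z \<Longrightarrow> \<forall>f\<in>F. \<not> (y < f \<and> f \<le> z) \<Longrightarrow> R z - z = R y - y"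
    and y: "y \<in> {0..<1}" and far: "\<And>f. f \<in> F \<Longrightarrow> 3 * \<eta> \<le> \<bar>y - f\<bar>"
  shows "A (S (A (R y))) = S (A (R (A y)))"
proof -
  have h: "h > 0" "real N * h = 1" using N by (simp_all add: h_def)
  have cell: "\<exists>j<N. real j * h \<le> x \<and> x < (real j + 1) * h" if "x \<in> {0..<1}" for x
  proof -
    define j where "j = nat \<lfloor>x * N\<rfloor>"
    have j: "real j \<le> x * N" "x * N < real j + 1" using that by (auto simp: j_def) 
    have "x * N < real N" using that N by simp
    then have "j < N" using j by linarith
    moreover have "real j * h \<le> x" "x < (real j + 1) * h"
      using j N by (auto simp: h_def field_simps)
    ultimately show ?thesis by blast
  qed
  have F1: "real j * h \<in> F" if "j \<le> N" for j
    using F that h by (cases "j = N") auto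
  \<comment> \<open>Distance \<open>3 * \<eta>\<close> leaves room for two translations by at most
    \<open>\<eta>\<close> and for the margin \<open>\<eta>\<close> in the hypothesis on
    \<open>A\<close>.\<close>
  have margin: "real j * h + 3 * \<eta> \<le> y \<and> y \<le> (real j + 1) * h - 3 * \<eta>"
    if "j < N" "real j * h \<le> y" "y < (real j + 1) * h" for j
    using far[OF F1[of j]] far[OF F1[of "Suc j"]] that by (auto simp: abs_if add.commute split: if_splits)
  have y01: "3 * \<eta> \<le> y" "y \<le> 1 - 3 * \<eta>" using far[OF F1[of 0]] far[OF F(1)] y by (auto simp: abs_if split: if_splits)
  have trans: "R z = R y + (z - y)" if "\<bar>z - y\<bar> < 3 * \<eta>" for z
  proof -
    have z: "z \<in> {0..<1}" using that y01 by auto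
    have "\<not> (min y z < f \<and> f \<le> max y z)" if "f \<in> F" for f
      using far[OF that] \<open>\<bar>z - y\<bar> < 3 * \<eta>\<close> by (auto simp: abs_if min_def max_def split: if_splits)
    then have "R (max y z) - max y z = R (min y z) - min y z" using y z by (intro R) (auto simp: min_def max_def)
    then show ?thesis by (auto simp: min_def max_def split: if_splits)
  qed
  obtain j where j: "j < N" "real j * h \<le> y" "y < (real j + 1) * h" using cell[OF y] by blast
  obtain i where i: "i < N" "real i * h \<le> R y" "R y < (real i + 1) * h" using cell[of "R y"] SR[OF y] by blast
  \<comment> \<open>\<open>R\<close> is a translation around \<open>y\<close>. If \<open>R y\<close>
    were close to a grid point, \<open>y\<close> would be equally close to the image of this grid
    point under \<open>S\<close>, which lies in \<open>F\<close>.\<close>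
  have away: "3 * \<eta> \<le> \<bar>R y - real g * h\<bar>" if g: "g < N" for g
  proof (rule ccontr)
    assume near: "\<not> 3 * \<eta> \<le> \<bar>R y - real g * h\<bar>"
    define z where "z = y + (real g * h - R y)"
    have zy: "\<bar>z - y\<bar> < 3 * \<eta>" using near by (simp add: z_def abs_minus_commute)
    have "R z = real g * h" using trans[OF zy] by (simp add: z_def)
    moreover have "z \<in> {0..<1}" using zy y01 by auto
    ultimately have "S (real g * h) = z" using SR by metis
    then show False using far[OF F(3)[OF g]] zy by (simp add: abs_minus_commute)
  qed
  \<comment> \<open>The right end of the last cell is 1, outside the domain of \<open>S\<close>.
    There the argument is that \<open>R\<close> would take the value 1 at a point near
    \<open>y\<close>.\<close>
  have up: "R y \<le> (real i + 1) * h - 3 * \<eta>"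
  proof (cases "Suc i < N")
    case True
    then show ?thesis using away[OF True] i by (auto simp: abs_if add.commute split: if_splits)
  next
    case False
    then have e: "real i + 1 = real N" using i by linarith
    show ?thesis
    proof (rule ccontr)
      assume "\<not> ?thesis"
      then have r: "1 - 3 * \<eta> < R y" "R y < 1" using i(3) h by (auto simp: e)
      then have "R (y + (1 - R y)) = 1" using trans[of "y + (1 - R y)"] by simp
      moreover have "y + (1 - R y) \<in> {0..<1}" using r y01 by auto
      ultimately show False using SR by fastforce
    qed
  qed
  have lo: "real i * h + 3 * \<eta> \<le> R y" using away[OF i(1)] i by (auto simp: abs_if split: if_splits)
  note dj = d[OF j(1)] and di = d[OF i(1)] and m = margin[OF j]
  have 1: "A (R y) = R (y + d i)" using A[OF i(1), of "R y"] trans[of "y + d i"] di lo up \<eta> by auto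
  have "y + d i \<in> {0..<1}" using y01 di \<eta> by auto
  then have 2: "S (A (R y)) = y + d i" using 1 SR by simp
  have 3: "A (y + d i) = y + d i + d j" using A[OF j(1), of "y + d i"] di m \<eta> by auto
  have 4: "A y = y + d j" using A[OF j(1), of y] m \<eta> by auto
  have 5: "R (y + d j) = R y + d j" using trans[of "y + d j"] dj \<eta> by auto
  have 6: "A (R y + d j) = R y + d j + d i" using A[OF i(1), of "R y + d j"] dj lo up \<eta> by auto
  have 7: "R (y + d j + d i) = R y + d j + d i" using trans[of "y + d j + d i"] dj di \<eta> by auto
  have "y + d j + d i \<in> {0..<1}" using y01 di dj \<eta> by auto
  then have "S (R y + d j + d i) = y + d j + d i" using 7 SR by metis
  then show ?thesis by (simp add: 2 3 4 5 6)
qed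

section \<open>Displacement by the accumulated drift\<close>

lemma iterate_drift:
  fixes T :: "real \<Rightarrow> real" and h :: real
  assumes T: "\<And>x. x \<in> {0..<1} \<Longrightarrow> T x \<in> {0..<1}"
    and drift: "\<And>x. x \<in> {0..<1} \<Longrightarrow> \<exists>k::int. \<exists>\<epsilon>. \<alpha> \<le> \<epsilon> \<and> \<epsilon> \<le> \<beta> \<and> T x = x + k * h + \<epsilon>"
    and x: "x \<in> {0..<1}"
  shows "(T ^^ m) x \<in> {0..<1} \<and>
    (\<exists>k::int. \<exists>D. real m * \<alpha> \<le> D \<and> D \<le> real m * \<beta> \<and> (T ^^ m) x = x + k * h + D)"
proof (induction m)
  case 0
  then show ?case using x by (auto intro!: exI[of _ 0])
next
  case (Suc m)
  then obtain k :: int and D where kD: "(T ^^ m) x \<in> {0..<1}" "real m * \<alpha> \<le> D" "D \<le> real m * \<beta>"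
    "(T ^^ m) x = x + k * h + D" by blast
  obtain k' :: int and \<epsilon> where ke: "\<alpha> \<le> \<epsilon>" "\<epsilon> \<le> \<beta>" "T ((T ^^ m) x) = (T ^^ m) x + k' * h + \<epsilon>"
    using drift[OF kD(1)] by blast
  have "T ((T ^^ m) x) = x + (k + k') * h + (D + \<epsilon>)" using ke kD by (simp add: algebra_simps)
  moreover have "real (Suc m) * \<alpha> \<le> D + \<epsilon>" "D + \<epsilon> \<le> real (Suc m) * \<beta>"
    using kD ke by (auto simp: algebra_simps)
  ultimately show ?case using T[OF kD(1)] by (metis comp_apply funpow.simps(2))
qed

text \<open>By \<open>conjugate_commutes_off_finite\<close>, commutation can fail only within
  \<open>3 * \<eta>\<close> of a finite set \<open>F\<close>, where
  \<open>\<eta> = L * \<delta>\<close>. Modulo \<open>h\<close>, \<open>T ^^ m\<close> moves points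
  by an amount between \<open>m * a * \<delta>\<close> and \<open>m * b * \<delta>\<close>. If
  \<open>x\<close> and its image were both near \<open>F\<close>, some difference
  \<open>f' - f - k * h\<close> would be positive but smaller than any such difference can
  be.\<close>

theorem drift_displaces_commutator:
  fixes S R :: "real \<Rightarrow> real" and N p :: nat and a b K h :: real
  defines "h \<equiv> 1 / real N" and "p \<equiv> fact N"
  assumes N: "0 < N" and ab: "0 < a" "a \<le> b" and K: "0 \<le> K"
    and SR: "\<And>x. x \<in> {0..<1} \<Longrightarrow> S x \<in> {0..<1} \<and> R x \<in> {0..<1} \<and> R (S x) = x \<and> S (R x) = x"
    and E: "finite E"
    and R: "\<And>y z. y \<in> {0..<1} \<Longrightarrow> z \<in> {0..<1} \<Longrightarrow> y \<le> z \<Longrightarrow> \<forall>f\<in>E. \<not> (y < f \<and> f \<le> z) \<Longrightarrow> R z - z = R y - y"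
  shows "\<exists>m>0. \<exists>\<delta>\<^sub>0>0. \<forall>\<delta> T (x :: real). 0 < \<delta> \<longrightarrow> \<delta> < \<delta>\<^sub>0 \<longrightarrow>
    (\<forall>x\<in>{0..<1}. T x \<in> {0..<1}) \<longrightarrow> inj_on T {0..<1} \<longrightarrow>
    (\<forall>x\<in>{0..<1}. \<exists>k::int. \<exists>\<epsilon>. a * \<delta> \<le> \<epsilon> \<and> \<epsilon> \<le> b * \<delta> \<and> T x = x + k * h + \<epsilon>) \<longrightarrow>
    (\<forall>j<N. \<forall>x y. real j * h + K * \<delta> \<le> x \<longrightarrow> x < (real j + 1) * h - K * \<delta> \<longrightarrow>
       real j * h + K * \<delta> \<le> y \<longrightarrow> y < (real j + 1) * h - K * \<delta> \<longrightarrow> T y - y = T x - x) \<longrightarrow>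
    x \<in> {0..<1} \<longrightarrow>
    (let A = T ^^ p; commutes = (\<lambda>x. A (S (A (R x))) = S (A (R (A x)))) in commutes x \<or> commutes ((T ^^ m) x))"
proof -
  have h: "h > 0" using N by (simp add: h_def)
  have b: "b > 0" using ab by simp
  define F where "F = E \<union> {1} \<union> (\<lambda>j. real j * h) ` {..<N} \<union> (\<lambda>j. S (real j * h)) ` {..<N}"
  have finF: "finite F" using E by (simp add: F_def)
  \<comment> \<open>\<open>L * \<delta>\<close> is the margin \<open>\<kappa> + p * \<beta>\<close>
    of \<open>power_near_identity\<close> with \<open>\<kappa> = K * \<delta>\<close> and
    \<open>\<beta> = b * \<delta>\<close>.\<close>
  define L where "L = K + p * b"
  have L: "L > 0" using K b by (simp add: L_def p_def add_nonneg_pos)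
  \<comment> \<open>Makes the smallest possible drift \<open>m * a * \<delta>\<close> exceed
    \<open>6 * \<eta>\<close>, the combined uncertainty of the two distances to \<open>F\<close>.
    The choice does not involve \<open>\<delta>\<close>.\<close>
  define m where "m = nat \<lceil>6 * L / a\<rceil> + 1"
  have "6 * L / a < real m" by (simp add: m_def) linarith
  then have m: "6 * L < real m * a" "m > 0" using ab by (auto simp: field_simps m_def)
  define Z where "Z = (\<lambda>(f, f', k). f' - f - real_of_int k * h) ` (F \<times> F \<times> {- 2 * int N..2 * int N})"
  \<comment> \<open>The least positive difference. The inserted 1 makes the minimum exist and gives
    \<open>\<gamma> \<le> 1\<close>; then the drift is below 1 and \<open>k * h\<close> below 2 in
    absolute value, which explains the range of \<open>k\<close> in \<open>Z\<close>.\<close>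
  define \<gamma> where "\<gamma> = Min (insert 1 {z \<in> Z. z > 0})"
  have finZ: "finite (insert 1 {z \<in> Z. z > 0})" using finF by (simp add: Z_def)
  have \<gamma>: "\<gamma> > 0" "\<And>z. z \<in> Z \<Longrightarrow> z > 0 \<Longrightarrow> \<gamma> \<le> z" "\<gamma> \<le> 1"
    unfolding \<gamma>_def using finZ by auto
  \<comment> \<open>The first bound keeps the largest drift plus \<open>6 * \<eta>\<close> below
    \<open>\<gamma>\<close>; the second is the smallness condition of
    \<open>power_near_identity\<close>.\<close>
  define \<delta>\<^sub>0 where "\<delta>\<^sub>0 = min (\<gamma> / (real m * b + 6 * L)) (h / (2 * (K + b)))"
  have \<delta>\<^sub>0: "\<delta>\<^sub>0 > 0" using \<gamma> b L h K m by (simp add: \<delta>\<^sub>0_def add_pos_pos add_nonneg_pos)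
  show ?thesis
  proof (intro exI[of _ m] exI[of _ \<delta>\<^sub>0] conjI m(2) \<delta>\<^sub>0 allI impI)
    fix \<delta> T and x :: real
    assume \<delta>: "0 < \<delta>" "\<delta> < \<delta>\<^sub>0"
      and T: "\<forall>x\<in>{0..<1}. T x \<in> {0..<1}" and inj: "inj_on T {0..<1}"
      and drift: "\<forall>x\<in>{0..<1}. \<exists>k::int. \<exists>\<epsilon>. a * \<delta> \<le> \<epsilon> \<and> \<epsilon> \<le> b * \<delta> \<and> T x = x + k * h + \<epsilon>"
      and loc: "\<forall>j<N. \<forall>x y. real j * h + K * \<delta> \<le> x \<longrightarrow> x < (real j + 1) * h - K * \<delta> \<longrightarrow>
       real j * h + K * \<delta> \<le> y \<longrightarrow> y < (real j + 1) * h - K * \<delta> \<longrightarrow> T y - y = T x - x"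
      and x: "x \<in> {0..<1}"
    have "\<delta> < \<gamma> / (real m * b + 6 * L)" "\<delta> < h / (2 * (K + b))" using \<delta> by (auto simp: \<delta>\<^sub>0_def)
    moreover have "0 < real m * b + 6 * L" "0 < 2 * (K + b)" using b L K by (auto simp: add_nonneg_pos)
    ultimately have s: "(real m * b + 6 * L) * \<delta> < \<gamma>" "K * \<delta> + b * \<delta> < h / 2"
      by (auto simp: field_simps)
    define \<eta> where "\<eta> = L * \<delta>"
    have \<eta>: "\<eta> > 0" "K * \<delta> + p * (b * \<delta>) = \<eta>"
      using mult_pos_pos[OF L \<delta>(1)] by (simp_all add: \<eta>_def L_def algebra_simps)
    have a\<delta>: "0 \<le> a * \<delta>" using ab \<delta> by simp
    have "\<exists>d. \<forall>j<N. 0 \<le> d j \<and> d j \<le> p * (b * \<delta>) \<and>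
      (\<forall>x. real j * h + (K * \<delta> + p * (b * \<delta>)) \<le> x \<longrightarrow> x < (real j + 1) * h - (K * \<delta> + p * (b * \<delta>)) \<longrightarrow> (T ^^ p) x = x + d j)"
      unfolding h_def p_def
    proof (rule power_near_identity)
      show "0 \<le> K * \<delta>" "0 \<le> b * \<delta>" using K b \<delta> by auto
      show "K * \<delta> + b * \<delta> < 1 / real N / 2" using s(2) by (simp add: h_def)
      show "\<exists>k::int. \<exists>\<epsilon>\<ge>0. \<epsilon> \<le> b * \<delta> \<and> T x = x + k * (1 / real N) + \<epsilon>" if "x \<in> {0..<1}" for x
        using bspec[OF drift that] a\<delta> unfolding h_def by (meson order_trans)
      show "T y - y = T x - x" if "j < N" "real j * (1 / real N) + K * \<delta> \<le> x" "x < (real j + 1) * (1 / real N) - K * \<delta>"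
        "real j * (1 / real N) + K * \<delta> \<le> y" "y < (real j + 1) * (1 / real N) - K * \<delta>" for j x y
        using loc that unfolding h_def by blast
    qed (use N T inj in auto)
    then obtain d where d: "\<And>j. j < N \<Longrightarrow> 0 \<le> d j \<and> d j \<le> p * (b * \<delta>)"
      "\<And>j x. j < N \<Longrightarrow> real j * h + \<eta> \<le> x \<Longrightarrow> x < (real j + 1) * h - \<eta> \<Longrightarrow> (T ^^ p) x = x + d j"
      unfolding \<eta>(2) by blast
    have d\<eta>: "0 \<le> d j \<and> d j \<le> \<eta>" if "j < N" for j
      using d(1)[OF that] \<eta>(2) K \<delta> by (smt (verit) mult_nonneg_nonneg)
    let ?A = "T ^^ p"
    let ?c = "\<lambda>x. ?A (S (?A (R x))) = S (?A (R (?A x)))"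
    have near: "\<exists>f\<in>F. \<bar>y - f\<bar> < 3 * \<eta>" if y: "y \<in> {0..<1}" and nc: "\<not> ?c y" for y
    proof (rule ccontr)
      assume "\<not> ?thesis"
      then have far: "\<And>f. f \<in> F \<Longrightarrow> 3 * \<eta> \<le> \<bar>y - f\<bar>" by (auto simp: not_less)
      have "?c y"
      proof (rule conjugate_commutes_off_finite[OF N \<eta>(1) d\<eta>])
        show "R z - z = R y - y" if "y \<in> {0..<1}" "z \<in> {0..<1}" "y \<le> z" "\<forall>f\<in>F. \<not> (y < f \<and> f \<le> z)" for y z
          using that by (intro R) (auto simp: F_def)
      qed (use d(2) SR y far in \<open>auto simp: F_def h_def\<close>)
      then show False using nc by simp
    qed
    have "?c x \<or> ?c ((T ^^ m) x)"
    proof (rule ccontr)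
      assume nc: "\<not> ?thesis"
      have "(T ^^ m) x \<in> {0..<1} \<and> (\<exists>k::int. \<exists>D. real m * (a * \<delta>) \<le> D \<and> D \<le> real m * (b * \<delta>) \<and> (T ^^ m) x = x + k * h + D)"
        by (rule iterate_drift) (use T drift x in blast)+
      then obtain k :: int and D where kD: "(T ^^ m) x \<in> {0..<1}" "real m * (a * \<delta>) \<le> D" "D \<le> real m * (b * \<delta>)"
        "(T ^^ m) x = x + k * h + D" by blast
      obtain f where f: "f \<in> F" "\<bar>x - f\<bar> < 3 * \<eta>" using near[OF x] nc by blast
      obtain f' where f': "f' \<in> F" "\<bar>(T ^^ m) x - f'\<bar> < 3 * \<eta>" using near[OF kD(1)] nc by blast
      define z where "z = f' - f - k * h"
      have zD: "\<bar>z - D\<bar> < 6 * \<eta>" using f f' kD(4) by (auto simp: z_def abs_if split: if_splits)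
      have "6 * \<eta> < real m * (a * \<delta>)" using mult_strict_right_mono[OF m(1) \<delta>(1)] by (simp add: \<eta>_def algebra_simps)
      then have z0: "z > 0" using zD kD by linarith
      have "real m * (b * \<delta>) + 6 * \<eta> < \<gamma>" using s(1) by (simp add: \<eta>_def algebra_simps)
      then have z\<gamma>: "z < \<gamma>" using zD kD by linarith
      have "D < 1" "0 \<le> D" using kD \<open>real m * (b * \<delta>) + 6 * \<eta> < \<gamma>\<close> \<gamma> \<eta> a\<delta> mult_nonneg_nonneg[of "real m" "a * \<delta>"] by linarith+
      then have "\<bar>k * h\<bar> < 2" using kD x by (auto simp: abs_if)
      then have "\<bar>real_of_int k\<bar> < 2 * real N" using h N by (simp add: h_def abs_mult field_simps)
      then have "k \<in> {- 2 * int N..2 * int N}" by (auto simp: abs_if split: if_splits)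
      then have "z \<in> Z" using f f' unfolding Z_def z_def by force
      then show False using \<gamma>(2) z0 z\<gamma> by force
    qed
    then show "let A = T ^^ p; commutes = (\<lambda>x. A (S (A (R x))) = S (A (R (A x)))) in commutes x \<or> commutes ((T ^^ m) x)"
      by (simp add: Let_def)
  qed
qed

section \<open>The relation in the group of exchanges\<close>

abbreviation unit_grp :: "(real \<Rightarrow> real) monoid" where
  "unit_grp \<equiv> BijGroup {0..<1}"

text \<open>Group theory is applied in the ambient group \<open>unit_grp\<close>. For this, the
  inverse formed in \<open>iet_group\<close>, whose carrier is only \<open>IET\<close>, has to be
  identified with the ambient one.\<close>

lemma inv_iet_group:
  assumes "X \<in> IET"
  shows "inv\<^bsub>iet_group\<^esub> X = inv\<^bsub>unit_grp\<^esub> X" "inv\<^bsub>unit_grp\<^esub> X \<in> IET"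
    and "\<And>R. R \<in> IET \<Longrightarrow> (\<And>x. x \<in> {0..<1} \<Longrightarrow> R (X x) = x) \<Longrightarrow> inv\<^bsub>unit_grp\<^esub> X = R"
proof -
  interpret G: group unit_grp by (rule group_BijGroup)
  have sub: "IET \<subseteq> carrier unit_grp" by (auto simp: IET_def BijGroup_def)
  have XB: "X \<in> carrier unit_grp" using assms sub by blast
  show eq: "inv\<^bsub>unit_grp\<^esub> X = R" if R: "R \<in> IET" "\<And>x. x \<in> {0..<1} \<Longrightarrow> R (X x) = x" for R
  proof (rule G.inv_equality)
    have "X \<in> Bij {0..<1}" "R \<in> Bij {0..<1}" using assms R by (auto simp: IET_def)
    then show "R \<otimes>\<^bsub>unit_grp\<^esub> X = \<one>\<^bsub>unit_grp\<^esub>"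
      using R(2) by (auto simp: BijGroup_def compose_def intro!: restrict_ext)
  qed (use R sub XB in auto)
  obtain R where "R \<in> IET" "\<forall>x\<in>{0..<1}. R (X x) = x"
    using IET_inverse[OF assms] by (auto simp del: atLeastLessThan_iff)
  then show mem: "inv\<^bsub>unit_grp\<^esub> X \<in> IET" using eq by simp
  show "inv\<^bsub>iet_group\<^esub> X = inv\<^bsub>unit_grp\<^esub> X"
    unfolding m_inv_def[of iet_group]
  proof (rule the_equality)
    show "inv\<^bsub>unit_grp\<^esub> X \<in> carrier iet_group \<and>
        X \<otimes>\<^bsub>iet_group\<^esub> inv\<^bsub>unit_grp\<^esub> X = \<one>\<^bsub>iet_group\<^esub> \<and> inv\<^bsub>unit_grp\<^esub> X \<otimes>\<^bsub>iet_group\<^esub> X = \<one>\<^bsub>iet_group\<^esub>"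
      using mem XB by (simp add: iet_group_def)
    fix Y assume "Y \<in> carrier iet_group \<and> X \<otimes>\<^bsub>iet_group\<^esub> Y = \<one>\<^bsub>iet_group\<^esub> \<and> Y \<otimes>\<^bsub>iet_group\<^esub> X = \<one>\<^bsub>iet_group\<^esub>"
    then show "Y = inv\<^bsub>unit_grp\<^esub> X"
      using XB sub by (intro G.inv_equality[symmetric]) (auto simp: iet_group_def)
  qed
qed

text \<open>Both structures share multiplication and unit, and by \<open>inv_iet_group\<close> also
  the inverses of elements of \<open>X\<close>. The generated subgroup can therefore be treated as a
  subgroup of \<open>unit_grp\<close>.\<close>

lemma subgroup_generated_iet_group:
  assumes "X \<subseteq> IET"
  shows "subgroup_generated iet_group X = unit_grp\<lparr>carrier := generate unit_grp X\<rparr>"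
proof -
  have "h \<in> generate unit_grp X" if "h \<in> generate iet_group X" for h
    using that
  proof induction
    case one
    then show ?case using generate.one[of unit_grp X] by (simp add: iet_group_def)
  next
    case (inv h)
    then show ?case using generate.inv[of h X unit_grp] inv_iet_group(1)[of h] assms by auto
  next
    case (eng h k)
    then show ?case using generate.eng[of h unit_grp X k] by (simp add: iet_group_def)
  qed (rule generate.incl)
  moreover have "h \<in> generate iet_group X" if "h \<in> generate unit_grp X" for h
    using that
  proof induction
    case one
    then show ?case using generate.one[of iet_group X] by (simp add: iet_group_def)
  next
    case (inv h)
    then show ?case using generate.inv[of h X iet_group] inv_iet_group(1)[of h] assms by auto
  next
    case (eng h k)
    then show ?case using generate.eng[of h iet_group X k] by (simp add: iet_group_def)
  qed (rule generate.incl)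
  moreover have "IET \<inter> X = X" using assms by auto
  ultimately have "generate iet_group (carrier iet_group \<inter> X) = generate unit_grp X"
    by (auto simp: iet_group_def)
  then show ?thesis by (simp add: subgroup_generated_def) (simp add: iet_group_def)
qed

lemma (in group) displaced_commute_subgroup:
  assumes "subgroup H G" "s \<in> H" "t \<in> H"
  shows "displaced_commute (G\<lparr>carrier := H\<rparr>) p m s t \<longleftrightarrow> displaced_commute G p m s t"
proof -
  interpret H: group "G\<lparr>carrier := H\<rparr>" using assms(1) by (rule subgroup_imp_group)
  have pow: "t [^]\<^bsub>G\<lparr>carrier := H\<rparr>\<^esub> k = t [^] k" for k :: nat using nat_pow_consistent[of t k] by simp
  have cl: "t [^] k \<in> H" for k :: nat using H.nat_pow_closed[of t k] assms(3) by (simp add: pow)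
  have inv: "inv\<^bsub>G\<lparr>carrier := H\<rparr>\<^esub> x = inv x" if "x \<in> H" for x using m_inv_consistent[OF assms(1) that] .
  have mul: "x \<otimes> y \<in> H" if "x \<in> H" "y \<in> H" for x y
    using assms(1) that by (auto simp: subgroup_def)
  have invH: "inv x \<in> H" if "x \<in> H" for x using assms(1) that by (auto simp: subgroup_def)
  show ?thesis
    by (simp add: displaced_commute_def conj_commutator_def Let_def pow inv cl mul invH assms)
qed

section \<open>Pointwise computation with bijections of \<open>[0,1)\<close>\<close>

lemma unit_grp_mult:
  "g \<in> carrier unit_grp \<Longrightarrow> f \<in> carrier unit_grp \<Longrightarrow> x \<in> {0..<1} \<Longrightarrow> (g \<otimes>\<^bsub>unit_grp\<^esub> f) x = g (f x)"
  by (simp add: BijGroup_def compose_def)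

lemma unit_grp_mem: "g \<in> carrier unit_grp \<Longrightarrow> x \<in> {0..<1} \<Longrightarrow> g x \<in> {0..<1}"
  using Bij_imp_funcset[of g "{0..<1}"] by (auto simp: BijGroup_def Pi_iff)

lemma unit_grp_eqI:
  assumes "g \<in> carrier unit_grp" "f \<in> carrier unit_grp" "\<And>x. x \<in> {0..<1} \<Longrightarrow> g x = f x"
  shows "g = f"
  using assms by (auto simp: BijGroup_def intro!: extensionalityI[of _ "{0..<1}"] dest: Bij_imp_extensional)

lemma unit_grp_inv:
  assumes "g \<in> carrier unit_grp" "x \<in> {0..<1}"
  shows "(inv\<^bsub>unit_grp\<^esub> g) (g x) = x" "g ((inv\<^bsub>unit_grp\<^esub> g) x) = x"
proof -
  interpret G: group unit_grp by (rule group_BijGroup)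
  have one: "\<one>\<^bsub>unit_grp\<^esub> x = x" using assms by (simp add: BijGroup_def)
  show "(inv\<^bsub>unit_grp\<^esub> g) (g x) = x" "g ((inv\<^bsub>unit_grp\<^esub> g) x) = x"
    using assms one unit_grp_mult[of "inv\<^bsub>unit_grp\<^esub> g" g x] unit_grp_mult[of g "inv\<^bsub>unit_grp\<^esub> g" x] by simp_all
qed

lemma unit_grp_pow:
  assumes "g \<in> carrier unit_grp" "x \<in> {0..<1}"
  shows "(g [^]\<^bsub>unit_grp\<^esub> (k :: nat)) x = (g ^^ k) x"
proof -
  interpret G: group unit_grp by (rule group_BijGroup)
  have "\<forall>x\<in>{0..<1}. (g [^]\<^bsub>unit_grp\<^esub> k) x = (g ^^ k) x"
  proof (induction k)
    case 0
    then show ?case by (simp add: BijGroup_def)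
  next
    case (Suc k)
    have "(g [^]\<^bsub>unit_grp\<^esub> k \<otimes>\<^bsub>unit_grp\<^esub> g) x = (g ^^ k) (g x)" if "x \<in> {0..<1}" for x
      using assms that Suc unit_grp_mem by (subst unit_grp_mult) auto
    then show ?case by (simp add: funpow_Suc_right del: funpow.simps)
  qed
  then show ?thesis using assms by blast
qed

text \<open>The hypothesis \<open>disp\<close> says that \<open>g\<close> moves the support of
  \<open>C\<close> off itself. The support of \<open>D\<close> is the image under \<open>g\<close>
  of the support of \<open>C\<close>, so the supports are disjoint and the maps commute.\<close>

lemma commute_if_displaced:
  assumes C: "C \<in> carrier unit_grp" and g: "g \<in> carrier unit_grp"
    and disp: "\<And>x. x \<in> {0..<1} \<Longrightarrow> C x = x \<or> C (g x) = g x"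
  defines "D \<equiv> g \<otimes>\<^bsub>unit_grp\<^esub> C \<otimes>\<^bsub>unit_grp\<^esub> inv\<^bsub>unit_grp\<^esub> g"
  shows "C \<otimes>\<^bsub>unit_grp\<^esub> D = D \<otimes>\<^bsub>unit_grp\<^esub> C"
proof -
  interpret G: group unit_grp by (rule group_BijGroup)
  let ?g' = "inv\<^bsub>unit_grp\<^esub> g"
  have D: "D \<in> carrier unit_grp" using C g by (simp add: D_def)
  have Dx: "D x = g (C (?g' x))" if "x \<in> {0..<1}" for x
    using C g that unit_grp_mem unfolding D_def by (subst unit_grp_mult | simp)+
  have injC: "x = y" if "C x = C y" "x \<in> {0..<1}" "y \<in> {0..<1}" for x y
    using unit_grp_inv(1)[OF C] that by metis
  show ?thesis
  proof (rule unit_grp_eqI)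
    fix x :: real assume x: "x \<in> {0..<1}"
    define y where "y = ?g' x"
    have y: "y \<in> {0..<1}" "g y = x" using x g unit_grp_mem unit_grp_inv(2) by (auto simp: y_def)
    have "C (D x) = D (C x)"
    proof (cases "C y = y")
      case True
      then have "D x = x" using Dx[OF x] y by (simp add: y_def)
      define w where "w = ?g' (C x)"
      have Cx: "C x \<in> {0..<1}" using C x unit_grp_mem by blast
      have w: "w \<in> {0..<1}" "g w = C x" using Cx g unit_grp_mem unit_grp_inv(2) by (auto simp: w_def)
      \<comment> \<open>Here \<open>D\<close> fixes \<open>x\<close> and must also fix
        \<open>C x\<close>. Otherwise \<open>C x\<close> would lie in the support of
        \<open>D\<close>, hence be fixed by \<open>C\<close>. Injectivity would give
        \<open>C x = x\<close>, and then \<open>w = y\<close> would be fixed by \<open>C\<close>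
        after all.\<close>
      have "C w = w"
      proof (rule ccontr)
        assume "C w \<noteq> w"
        then have "C (C x) = C x" using disp[OF w(1)] w by simp
        then have "C x = x" using injC x Cx by blast
        then show False using \<open>C w \<noteq> w\<close> True by (simp add: w_def y_def)
      qed
      then show ?thesis using Dx[OF Cx] w \<open>D x = x\<close> by (simp add: w_def)
    next
      case False
      have Cy: "C y \<in> {0..<1}" using C y unit_grp_mem by blast
      have "C x = x" using disp[OF y(1)] False y by simp
      moreover have "C (C y) \<noteq> C y" using injC False y Cy by blast
      then have "C (g (C y)) = g (C y)" using disp[OF Cy] by simp
      ultimately show ?thesis using Dx[OF x] by (simp add: y_def)
    qed
    then show "(C \<otimes>\<^bsub>unit_grp\<^esub> D) x = (D \<otimes>\<^bsub>unit_grp\<^esub> C) x" using C D x by (simp add: unit_grp_mult)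
  qed (use C D in auto)
qed

text \<open>The hypothesis \<open>c\<close> says that \<open>A B\<close> and \<open>B A\<close>
  agree at \<open>x\<close>, for \<open>A = T^p\<close> and \<open>B = S A R\<close>.\<close>

lemma conj_commutator_fixed:
  assumes S: "S \<in> carrier unit_grp" and T: "T \<in> carrier unit_grp"
    and R: "R = inv\<^bsub>unit_grp\<^esub> S" and x: "x \<in> {0..<1}"
    and c: "(T ^^ p) (S ((T ^^ p) (R x))) = S ((T ^^ p) (R ((T ^^ p) x)))"
  shows "conj_commutator unit_grp p S T x = x"
proof -
  interpret G: group unit_grp by (rule group_BijGroup)
  define A where "A = T [^]\<^bsub>unit_grp\<^esub> p"
  define B where "B = S \<otimes>\<^bsub>unit_grp\<^esub> A \<otimes>\<^bsub>unit_grp\<^esub> R"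
  have mem: "A \<in> carrier unit_grp" "R \<in> carrier unit_grp" "B \<in> carrier unit_grp"
    using S T R by (auto simp: A_def B_def)
  have A: "A z = (T ^^ p) z" if "z \<in> {0..<1}" for z unfolding A_def by (rule unit_grp_pow[OF T that])
  have B: "B z = S (A (R z))" if "z \<in> {0..<1}" for z
    using S mem that unit_grp_mem unfolding B_def by (subst unit_grp_mult | simp)+
  note um = unit_grp_mem[OF S] unit_grp_mem[OF mem(1)] unit_grp_mem[OF mem(2)] unit_grp_mem[OF mem(3)]
  have "A (B x) = B (A x)"
    using c x um by (simp add: A[symmetric] B del: atLeastLessThan_iff)
  then have "(A \<otimes>\<^bsub>unit_grp\<^esub> B) x = (B \<otimes>\<^bsub>unit_grp\<^esub> A) x" using x mem by (simp add: unit_grp_mult)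
  then have "(inv\<^bsub>unit_grp\<^esub> (B \<otimes>\<^bsub>unit_grp\<^esub> A) \<otimes>\<^bsub>unit_grp\<^esub> (A \<otimes>\<^bsub>unit_grp\<^esub> B)) x = x"
    using x mem unit_grp_inv(1)[of "B \<otimes>\<^bsub>unit_grp\<^esub> A" x] by (subst unit_grp_mult) auto
  then show ?thesis by (simp add: conj_commutator_def Let_def A_def B_def R)
qed

text \<open>By \<open>disp\<close>, \<open>T^m\<close> moves the support of the commutator off
  itself, so \<open>S\<close> and \<open>T\<close> satisfy the relation
  \<open>displaced_commute\<close>. If they generated a free group of rank 2, some homomorphism
  would send them to a pair in a finite group that violates it.\<close>

theorem not_free_if_displaced:
  assumes S: "S \<in> IET" and T: "T \<in> IET" and p: "p > 0" and m: "m > 0"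
    and R: "R \<in> IET" "\<And>x. x \<in> {0..<1} \<Longrightarrow> R (S x) = x"
    and disp: "\<And>x. x \<in> {0..<1} \<Longrightarrow>
      (let A = T ^^ p; commutes = (\<lambda>x. A (S (A (R x))) = S (A (R (A x)))) in commutes x \<or> commutes ((T ^^ m) x))"
  shows "\<not> free_of_rank (subgroup_generated iet_group {S, T}) 2"
proof
  assume free: "free_of_rank (subgroup_generated iet_group {S, T}) 2"
  interpret G: group unit_grp by (rule group_BijGroup)
  have mem: "S \<in> carrier unit_grp" "T \<in> carrier unit_grp" using S T by (auto simp: IET_def BijGroup_def)
  define K where "K = generate unit_grp {S, T}"
  define H where "H = unit_grp\<lparr>carrier := K\<rparr>"
  have freeH: "free_of_rank H 2"
    using free subgroup_generated_iet_group[of "{S, T}"] S T by (simp add: H_def K_def)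
  have K: "subgroup K unit_grp" unfolding K_def using mem by (intro G.generate_is_subgroup) auto
  have ST: "S \<in> K" "T \<in> K" unfolding K_def by (auto intro: generate.incl)
  have R_inv: "R = inv\<^bsub>unit_grp\<^esub> S" using inv_iet_group(3)[OF S R] by simp
  have Tm: "T [^]\<^bsub>unit_grp\<^esub> m \<in> carrier unit_grp" using mem by simp
  have "displaced_commute unit_grp p m S T"
    unfolding displaced_commute_def Let_def
  proof (rule commute_if_displaced[OF G.conj_commutator_closed[OF mem] Tm])
    fix x :: real assume x: "x \<in> {0..<1}"
    have gx: "(T [^]\<^bsub>unit_grp\<^esub> m) x \<in> {0..<1}" "(T [^]\<^bsub>unit_grp\<^esub> m) x = (T ^^ m) x"
      using unit_grp_mem[OF Tm x] unit_grp_pow[OF mem(2) x] by auto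
    show "conj_commutator unit_grp p S T x = x \<or>
      conj_commutator unit_grp p S T ((T [^]\<^bsub>unit_grp\<^esub> m) x) = (T [^]\<^bsub>unit_grp\<^esub> m) x"
      using disp[OF x] conj_commutator_fixed[OF mem R_inv x] conj_commutator_fixed[OF mem R_inv gx(1)]
      unfolding gx(2) Let_def by blast
  qed
  then have rel: "displaced_commute H p m S T"
    unfolding H_def using G.displaced_commute_subgroup[OF K ST] by simp
  have gen: "generate H {S, T} = carrier H"
    using G.generate_consistent[OF _ K, of "{S, T}"] ST by (simp add: H_def K_def)
  obtain Q :: "(int \<times> int \<Rightarrow> int \<times> int) monoid" and s t where Q: "group Q" "finite (carrier Q)"
    "s \<in> carrier Q" "t \<in> carrier Q" "\<not> displaced_commute Q p m s t"
    using finite_group_not_displaced_commute[OF p m] by blast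
  have STH: "S \<in> carrier H" "T \<in> carrier H" using ST by (auto simp: H_def)
  obtain \<phi> where \<phi>: "\<phi> \<in> hom H Q" "\<phi> S = s" "\<phi> T = t"
    using free_rank2_hom_finite[OF freeH Q(1,2) STH gen Q(3,4)] .
  interpret group_hom H Q \<phi>
    using G.subgroup_imp_group[OF K] Q(1) \<phi>(1) by (simp add: group_hom_def group_hom_axioms_def H_def)
  show False using hom_displaced_commute[OF STH rel] \<phi> Q(5) by simp
qed

section \<open>Perturbing rational lengths\<close>

text \<open>\<open>E\<close> consists of the right ends of the pieces. Pieces are closed on the
  left, so two points lie in the same piece when no element of \<open>E\<close> lies in
  \<open>(y, z]\<close>.\<close>

lemma IET_local_translation:
  assumes "R \<in> IET"
  shows "\<exists>E. finite E \<and> (\<forall>y z. y \<in> {0..<1} \<longrightarrow> z \<in> {0..<1} \<longrightarrow> y \<le> z \<longrightarrow>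
    (\<forall>f\<in>E. \<not> (y < f \<and> f \<le> z)) \<longrightarrow> R z - z = R y - y)"
proof -
  define n \<sigma> l where "n = iet_num R" and "\<sigma> = iet_perm R" and "l = iet_length R"
  note st = IET_structure[OF assms, folded n_def \<sigma>_def l_def]
  show ?thesis
  proof (intro exI[of _ "brk l ` {1..n}"] conjI allI impI)
    show "finite (brk l ` {1..n})" by simp
    fix y z :: real
    assume y: "y \<in> {0..<1}" and z: "z \<in> {0..<1}" "y \<le> z" and no: "\<forall>f\<in>brk l ` {1..n}. \<not> (y < f \<and> f \<le> z)"
    obtain i where i: "1 \<le> i" "i \<le> n" "brk l (i - 1) \<le> y" "y < brk l i" using piece_exists[OF st(2) y] .
    then have "z < brk l i" using no by force
    then show "R z - z = R y - y"
      using mk_iet_piece[OF st(2) i] mk_iet_piece[OF st(2) i(1,2), of z] i z st(3) by simp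
  qed
qed

text \<open>\<open>A - {1..k}\<close> and \<open>{1..k} - A\<close> have the same size. Elements of
  the former are at least \<open>k + 1\<close> and those of the latter at most \<open>k\<close>, so
  each replacement of an outer element by a missing one lowers the sum by at least 1.\<close>

lemma sum_card_initial_le:
  fixes A :: "nat set"
  assumes "finite A" "0 \<notin> A" "card A = k"
  shows "(\<Sum>j = 1..k. int j) + int (card (A - {1..k})) \<le> (\<Sum>j\<in>A. int j)"
proof -
  let ?I = "{1..k}"
  have "card A = card (A \<inter> ?I) + card (A - ?I)" "card ?I = card (A \<inter> ?I) + card (?I - A)"
    using card_Int_Diff[OF assms(1), of ?I] card_Int_Diff[of ?I A] by (simp_all add: Int_commute)
  then have c: "card (?I - A) = card (A - ?I)" using assms(3) by simp
  have "(\<Sum>j\<in>?I - A. int j) \<le> (\<Sum>j\<in>?I - A. int k)" by (intro sum_mono) auto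
  moreover have "(\<Sum>j\<in>A - ?I. int k + 1) \<le> (\<Sum>j\<in>A - ?I. int j)"
  proof (intro sum_mono)
    fix j assume j: "j \<in> A - ?I"
    then have "j \<noteq> 0" using assms(2) by (intro notI) simp
    then show "int k + 1 \<le> int j" using j by simp
  qed
  ultimately have "(\<Sum>j\<in>?I - A. int j) + int (card (A - ?I)) \<le> (\<Sum>j\<in>A - ?I. int j)"
    using c by (simp add: algebra_simps)
  moreover have "(\<Sum>j\<in>A. int j) = (\<Sum>j\<in>A \<inter> ?I. int j) + (\<Sum>j\<in>A - ?I. int j)"
    using assms(1) by (simp add: sum.Int_Diff[of A _ ?I])
  moreover have "(\<Sum>j\<in>?I. int j) = (\<Sum>j\<in>A \<inter> ?I. int j) + (\<Sum>j\<in>?I - A. int j)"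
    using sum.Int_Diff[of ?I int A] by (simp add: Int_commute)
  ultimately show ?thesis by linarith
qed

text \<open>
  Lengthening the \<open>j\<close>-th interval at rate \<open>j - \<sigma>(j)\<close> moves every break point weakly to the left
  and every break point of the image weakly to the right. Admissibility says that no piece has
  both of its left end points stationary.
\<close>

lemma admissible_shift_pos:
  assumes \<sigma>: "\<sigma> permutes {1..n}" and adm: "admissible_perm n \<sigma>" and i: "1 \<le> i" "i \<le> n"
  defines "v \<equiv> \<lambda>j. real j - real (\<sigma> j)"
  shows "1 \<le> shift n \<sigma> v i"
proof -
  let ?P = "\<sigma> ` {1..i - 1}"
  let ?J = "{j \<in> {1..n}. \<sigma> j < \<sigma> i}"
  define s where "s = \<sigma> i"
  have s: "1 \<le> s" "s \<le> n" using permutes_mem[OF \<sigma> i] by (auto simp: s_def)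
  have inj: "inj_on \<sigma> A" for A using permutes_inj[OF \<sigma>] by (rule inj_on_subset) simp
  have cJ: "card ?J = s - 1" using card_permutes_less[OF \<sigma> i] by (simp add: s_def)
  have \<sigma>J: "\<sigma> ` ?J = {1..s - 1}"
  proof (rule card_subset_eq)
    have "\<sigma> j \<in> {1..s - 1}" if "j \<in> ?J" for j using permutes_mem[OF \<sigma>, of j] that by (auto simp: s_def)
    then show "\<sigma> ` ?J \<subseteq> {1..s - 1}" by blast
    show "card (\<sigma> ` ?J) = card {1..s - 1}" using cJ by (simp add: card_image[OF inj])
  qed simp
  have "card ?P = i - 1" by (simp add: card_image[OF inj])
  moreover have "0 \<notin> ?P"
  proof
    assume "0 \<in> ?P"
    then obtain j where j: "1 \<le> j" "j \<le> i - 1" "\<sigma> j = 0" by auto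
    then have "j \<le> n" using i by linarith
    then show False using permutes_mem[OF \<sigma>, of j] j by simp
  qed
  \<comment> \<open>The left end of piece \<open>i\<close> moves to the left, at a rate of at least
    the number of elements of \<open>?P\<close> outside \<open>{1..i - 1}\<close>. Below,
    \<open>2\<close> is the corresponding bound for the left end of its image moving to the
    right.\<close>
  ultimately have 1: "(\<Sum>j = 1..i - 1. int j) + int (card (?P - {1..i - 1})) \<le> (\<Sum>j = 1..i - 1. int (\<sigma> j))"
    using sum_card_initial_le[of ?P "i - 1"] by (simp add: sum.reindex[OF inj] o_def)
  have "(\<Sum>j = 1..s - 1. int j) + int (card (?J - {1..s - 1})) \<le> (\<Sum>j\<in>?J. int j)"
    using cJ by (intro sum_card_initial_le) auto
  moreover have "(\<Sum>j = 1..s - 1. int j) = (\<Sum>j\<in>?J. int (\<sigma> j))"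
    unfolding \<sigma>J[symmetric] by (simp add: sum.reindex[OF inj] o_def)
  ultimately have 2: "(\<Sum>j\<in>?J. int (\<sigma> j)) + int (card (?J - {1..s - 1})) \<le> (\<Sum>j\<in>?J. int j)" by simp
  \<comment> \<open>The shift as an integer, so that positivity yields the bound 1.\<close>
  define D where "D = (\<Sum>j\<in>?J. int j - int (\<sigma> j)) - (\<Sum>j = 1..i - 1. int j - int (\<sigma> j))"
  have D: "shift n \<sigma> v i = real_of_int D" by (simp add: shift_def img_brk_def brk_def v_def D_def)
  have D1: "int (card (?J - {1..s - 1})) + int (card (?P - {1..i - 1})) \<le> D"
    using 1 2 by (simp add: D_def sum_subtractf)
  \<comment> \<open>If both counts vanished, \<open>?J\<close> and \<open>?P\<close> would be
    initial segments. As \<open>i\<close> is not in \<open>?J\<close> and \<open>s\<close> is not in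
    \<open>?P\<close>, this forces \<open>s = i\<close>. Then \<open>\<sigma>\<close> fixes
    \<open>i\<close> and preserves \<open>{1..i}\<close>, against admissibility.\<close>
  have "card (?J - {1..s - 1}) + card (?P - {1..i - 1}) \<noteq> 0"
  proof
    assume "card (?J - {1..s - 1}) + card (?P - {1..i - 1}) = 0"
    then have sub: "?J \<subseteq> {1..s - 1}" "?P \<subseteq> {1..i - 1}" by auto
    have J: "?J = {1..s - 1}" using sub(1) cJ by (intro card_subset_eq) auto
    have P: "?P = {1..i - 1}" using sub(2) \<open>card ?P = i - 1\<close> by (intro card_subset_eq) auto
    have "i \<notin> ?J" by simp
    then have "s \<le> i" unfolding J using i by auto
    moreover have "s \<notin> ?P" using inj[of UNIV] i by (auto simp: s_def inj_eq)
    then have "i \<le> s" unfolding P using s by auto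
    ultimately have si: "\<sigma> i = i" by (simp add: s_def)
    have "{1..i} = insert i {1..i - 1}" using i by auto
    then have "\<sigma> ` {1..i} = {1..i}" using P si by (metis image_insert)
    then show False using adm i si by (auto simp: admissible_perm_def)
  qed
  then have "1 \<le> D" using D1 by linarith
  then show ?thesis unfolding D by simp
qed

section \<open>Linear estimates and rational approximation of lengths\<close>

lemma abs_sum_subset_le:
  fixes w :: "nat \<Rightarrow> real"
  assumes "A \<subseteq> {1..n}"
  shows "\<bar>\<Sum>j\<in>A. w j\<bar> \<le> (\<Sum>j = 1..n. \<bar>w j\<bar>)"
proof -
  have "\<bar>\<Sum>j\<in>A. w j\<bar> \<le> (\<Sum>j\<in>A. \<bar>w j\<bar>)" by (rule sum_abs)
  also have "\<dots> \<le> (\<Sum>j = 1..n. \<bar>w j\<bar>)" using assms by (intro sum_mono2) auto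
  finally show ?thesis .
qed

lemma abs_brk_le: "i \<le> n \<Longrightarrow> \<bar>brk w i\<bar> \<le> (\<Sum>j = 1..n. \<bar>w j\<bar>)"
  unfolding brk_def by (rule abs_sum_subset_le) auto

lemma abs_shift_le:
  assumes "i \<le> n"
  shows "\<bar>shift n \<sigma> w i\<bar> \<le> 2 * (\<Sum>j = 1..n. \<bar>w j\<bar>)"
proof -
  have "\<bar>img_brk n \<sigma> w i\<bar> \<le> (\<Sum>j = 1..n. \<bar>w j\<bar>)" unfolding img_brk_def by (rule abs_sum_subset_le) auto
  moreover have "\<bar>brk w (i - 1)\<bar> \<le> (\<Sum>j = 1..n. \<bar>w j\<bar>)" using assms by (intro abs_brk_le) simp
  ultimately show ?thesis unfolding shift_def by linarith
qed

lemma brk_linear: "brk (\<lambda>i. r i + \<delta> * v i + w i) i = brk r i + \<delta> * brk v i + brk w i"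
  by (simp add: brk_def sum.distrib sum_distrib_left)

lemma shift_linear:
  "shift n \<sigma> (\<lambda>i. r i + \<delta> * v i + w i) i = shift n \<sigma> r i + \<delta> * shift n \<sigma> v i + shift n \<sigma> w i"
  unfolding shift_def img_brk_def brk_linear by (simp add: sum.distrib sum_distrib_left right_diff_distrib)

text \<open>Rounding down the break points to multiples of \<open>1 / N\<close>, rather than the
  lengths, keeps the total exactly 1. \<open>N\<close> is so large that \<open>1 / N\<close> is
  below every length, which keeps the rounded lengths positive, and below \<open>e\<close>, which
  bounds the error.\<close>

lemma rational_lengths:
  assumes l: "is_lengths n l" and e: "0 < e"
  shows "\<exists>(N :: nat) (\<beta> :: nat \<Rightarrow> int). 0 < N \<and> \<beta> 0 = 0 \<and> \<beta> n = int N \<and>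
    (\<forall>i\<in>{1..n}. 1 \<le> \<beta> i - \<beta> (i - 1) \<and> \<bar>(\<beta> i - \<beta> (i - 1)) / N - l i\<bar> < e)"
proof -
  define \<mu> where "\<mu> = Min (insert e (l ` {1..n}))"
  have "\<forall>x\<in>insert e (l ` {1..n}). 0 < x" using e l by (auto simp: is_lengths_def)
  then have \<mu>: "0 < \<mu>" "\<mu> \<le> e" unfolding \<mu>_def by (simp_all add: Min_gr_iff Min_le)
  have \<mu>l: "\<mu> \<le> l i" if "1 \<le> i" "i \<le> n" for i unfolding \<mu>_def using that by (intro Min_le) auto
  obtain N :: nat where N: "1 / \<mu> < real N" using reals_Archimedean2 by blast
  have N0: "0 < real N" using N \<mu> by (meson less_trans zero_less_divide_1_iff)
  have N\<mu>: "1 < real N * \<mu>" using N \<mu> by (simp add: field_simps)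
  define \<beta> where "\<beta> i = \<lfloor>real N * brk l i\<rfloor>" for i
  show ?thesis
  proof (intro exI[of _ N] exI[of _ \<beta>] conjI ballI)
    show "0 < N" using N0 by simp
    show "\<beta> 0 = 0" "\<beta> n = int N" using brk_last[OF l] by (simp_all add: \<beta>_def)
    fix i assume "i \<in> {1..n}"
    then have i: "1 \<le> i" "i \<le> n" by auto
    have step: "real N * brk l i = real N * brk l (i - 1) + real N * l i"
      using brk_step[OF i(1), of l] by (simp add: distrib_left)
    have "real N * \<mu> \<le> real N * l i" using \<mu>l[OF i] by (intro mult_left_mono) auto
    then show "1 \<le> \<beta> i - \<beta> (i - 1)" unfolding \<beta>_def step using N\<mu> by linarith
    have "\<bar>real_of_int (\<beta> i - \<beta> (i - 1)) - real N * l i\<bar> < 1" unfolding \<beta>_def step by linarith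
    also have "1 < real N * e" using N\<mu> mult_left_mono[OF \<mu>(2), of "real N"] by simp
    finally have "\<bar>real_of_int (\<beta> i - \<beta> (i - 1)) - real N * l i\<bar> < real N * e" .
    moreover have "(\<beta> i - \<beta> (i - 1)) / N - l i = (real_of_int (\<beta> i - \<beta> (i - 1)) - real N * l i) / N"
      using N0 by (simp add: field_simps)
    ultimately show "\<bar>(\<beta> i - \<beta> (i - 1)) / N - l i\<bar> < e" using N0 by (simp add: abs_divide field_simps)
  qed
qed

lemma iet_dist_less_iff:
  assumes "0 < e"
  shows "iet_dist f g < ennreal e \<longleftrightarrow> iet_num f = iet_num g \<and> iet_perm f = iet_perm g \<and>
     (\<Sum>i = 1..iet_num f. \<bar>iet_length f i - iet_length g i\<bar>) < e"
  using assms by (auto simp: iet_dist_def ennreal_less_iff sum_nonneg)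

text \<open>
  \<open>\<beta> i / N\<close> are the break points of the rational exchange and \<open>w\<close> is the deviation of \<open>g\<close>
  from the perturbation \<open>r + \<delta> v\<close> of its lengths \<open>r\<close>.
\<close>

lemma perturbed_rational_iet:
  fixes N :: nat and \<beta> :: "nat \<Rightarrow> int" and v w :: "nat \<Rightarrow> real" and \<delta> h :: real
  defines "h \<equiv> 1 / real N"
  defines "r \<equiv> \<lambda>i. (\<beta> i - \<beta> (i - 1)) * h"
  assumes N: "0 < N" and \<beta>: "\<beta> 0 = 0" and \<delta>: "0 < \<delta>"
    and l: "is_lengths n (\<lambda>i. r i + \<delta> * v i + w i)"
    and v: "\<And>i. 1 \<le> i \<Longrightarrow> i \<le> n \<Longrightarrow> 1 \<le> shift n \<sigma> v i"
    and V: "(\<Sum>i = 1..n. \<bar>v i\<bar>) \<le> V"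
    and w: "(\<Sum>i = 1..n. \<bar>w i\<bar>) \<le> \<delta> / 4"
  defines "g \<equiv> mk_iet n \<sigma> (\<lambda>i. r i + \<delta> * v i + w i)"
  shows "x \<in> {0..<1} \<Longrightarrow> \<exists>k::int. \<exists>\<epsilon>. 1 / 2 * \<delta> \<le> \<epsilon> \<and> \<epsilon> \<le> (2 * V + 1) * \<delta> \<and> g x = x + k * h + \<epsilon>"
    and "real j * h + (V + 1) * \<delta> \<le> x \<Longrightarrow> x < (real j + 1) * h - (V + 1) * \<delta> \<Longrightarrow>
       real j * h + (V + 1) * \<delta> \<le> y \<Longrightarrow> y < (real j + 1) * h - (V + 1) * \<delta> \<Longrightarrow> j < N \<Longrightarrow> g y - y = g x - x"
proof -
  let ?l = "\<lambda>i. r i + \<delta> * v i + w i"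
  have h: "0 < h" "real N * h = 1" using N by (simp_all add: h_def)
  have V0: "0 \<le> V" using V by (rule order_trans[rotated]) (simp add: sum_nonneg)
  have brk_r: "brk r i = \<beta> i * h" for i
    by (induction i) (simp_all add: \<beta> brk_Suc r_def algebra_simps)
  \<comment> \<open>Each break point stays within \<open>(V + 1) * \<delta>\<close> of a multiple of
    \<open>h\<close>; the cells are shrunk by the same amount.\<close>
  have near: "\<bar>brk ?l i - \<beta> i * h\<bar> \<le> (V + 1) * \<delta>" if "i \<le> n" for i
  proof -
    have "\<bar>\<delta> * brk v i\<bar> \<le> \<delta> * V"
      using abs_brk_le[OF that, of v] V \<delta> by (simp add: abs_mult)
    moreover have "\<bar>brk w i\<bar> \<le> \<delta> / 4" using abs_brk_le[OF that, of w] w by linarith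
    moreover have "brk ?l i = \<beta> i * h + \<delta> * brk v i + brk w i" by (simp add: brk_linear brk_r)
    moreover have "(V + 1) * \<delta> = \<delta> * V + \<delta>" by (simp add: algebra_simps)
    ultimately show ?thesis using \<delta> by linarith
  qed
  {
    assume x: "x \<in> {0..<1}"
    obtain i where i: "1 \<le> i" "i \<le> n" "brk ?l (i - 1) \<le> x" "x < brk ?l i" using piece_exists[OF l x] .
    \<comment> \<open>The shift of the rational exchange in units of \<open>h\<close>, an integer
      because its lengths are integral multiples of \<open>h\<close>.\<close>
    define k where "k = (\<Sum>j \<in> {j \<in> {1..n}. \<sigma> j < \<sigma> i}. \<beta> j - \<beta> (j - 1)) - \<beta> (i - 1)"
    have "(\<Sum>j \<in> {j \<in> {1..n}. \<sigma> j < \<sigma> i}. r j) = (\<Sum>j \<in> {j \<in> {1..n}. \<sigma> j < \<sigma> i}. \<beta> j - \<beta> (j - 1)) * h"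
      unfolding r_def of_int_sum sum_distrib_right ..
    then have "shift n \<sigma> r i = k * h"
      by (simp add: shift_def img_brk_def brk_r k_def left_diff_distrib)
    then have "g x = x + k * h + (\<delta> * shift n \<sigma> v i + shift n \<sigma> w i)"
      unfolding g_def using mk_iet_piece[OF l i] by (simp add: shift_linear)
    \<comment> \<open>The deviation \<open>w\<close> changes a shift by at most
      \<open>\<delta> / 2\<close>, while \<open>\<delta> * v\<close> contributes at least
      \<open>\<delta>\<close>. A drift of at least \<open>\<delta> / 2\<close> survives.\<close>
    moreover have W: "\<bar>shift n \<sigma> w i\<bar> \<le> \<delta> / 2" using abs_shift_le[OF i(2), of \<sigma> w] w by linarith
    have P: "\<delta> * 1 \<le> \<delta> * shift n \<sigma> v i" "\<delta> * shift n \<sigma> v i \<le> \<delta> * (2 * V)"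
      using v[OF i(1,2)] abs_shift_le[OF i(2), of \<sigma> v] V \<delta> by (auto intro!: mult_left_mono)
    have "(2 * V + 1) * \<delta> = \<delta> * (2 * V) + \<delta>" by (simp add: algebra_simps)
    then have "1 / 2 * \<delta> \<le> \<delta> * shift n \<sigma> v i + shift n \<sigma> w i"
      "\<delta> * shift n \<sigma> v i + shift n \<sigma> w i \<le> (2 * V + 1) * \<delta>"
      using W P by linarith+
    ultimately show "\<exists>k::int. \<exists>\<epsilon>. 1 / 2 * \<delta> \<le> \<epsilon> \<and> \<epsilon> \<le> (2 * V + 1) * \<delta> \<and> g x = x + k * h + \<epsilon>"
      by blast
  }
  have cell: "z \<in> {0..<1}" if "real j * h + (V + 1) * \<delta> \<le> z" "z < (real j + 1) * h - (V + 1) * \<delta>" "j < N" for z j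
  proof -
    have "(real j + 1) * h \<le> real N * h" using that(3) h(1) by (intro mult_right_mono) auto
    moreover have "0 \<le> real j * h" "0 < (V + 1) * \<delta>" using h V0 \<delta> by auto
    ultimately have "0 \<le> z" "z < 1" using that h by linarith+
    then show ?thesis by simp
  qed
  \<comment> \<open>A break point separating two points of the shrunk cell \<open>j\<close> would
    put the integer \<open>\<beta> i\<close> strictly between \<open>j\<close> and
    \<open>j + 1\<close>.\<close>
  have no_break: "i' \<le> i"
    if x: "real j * h + (V + 1) * \<delta> \<le> x" and y: "y < (real j + 1) * h - (V + 1) * \<delta>" and i: "i \<le> n" "i' \<le> n"
      and b: "x < brk ?l i" "brk ?l (i' - 1) \<le> y" for x y j i i'
  proof (rule ccontr)
    assume "\<not> i' \<le> i"
    then have "brk ?l i \<le> brk ?l (i' - 1)" using i by (intro brk_mono[OF l]) auto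
    then have "real j * h < \<beta> i * h" "\<beta> i * h < (real j + 1) * h" using near[OF i(1)] x y b by (auto simp: abs_le_iff)
    then have "real j < real_of_int (\<beta> i)" "real_of_int (\<beta> i) < real j + 1"
      using h(1) mult_less_cancel_right_pos by blast+
    then have "int j < \<beta> i" "\<beta> i < int j + 1" by linarith+
    then show False by simp
  qed
  show "g y - y = g x - x"
    if x: "real j * h + (V + 1) * \<delta> \<le> x" "x < (real j + 1) * h - (V + 1) * \<delta>"
      and y: "real j * h + (V + 1) * \<delta> \<le> y" "y < (real j + 1) * h - (V + 1) * \<delta>" and j: "j < N"
  proof -
    obtain i where i: "1 \<le> i" "i \<le> n" "brk ?l (i - 1) \<le> x" "x < brk ?l i"
      using piece_exists[OF l cell[OF x j]] .
    obtain i' where i': "1 \<le> i'" "i' \<le> n" "brk ?l (i' - 1) \<le> y" "y < brk ?l i'"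
      using piece_exists[OF l cell[OF y j]] .
    have "i' = i"
      using no_break[OF x(1) y(2) i(2) i'(2) i(4) i'(3)] no_break[OF y(1) x(2) i'(2) i(2) i'(4) i(3)] by simp
    then show ?thesis unfolding g_def using mk_iet_piece[OF l i] mk_iet_piece[OF l i'] by simp
  qed
qed

section \<open>Balls in the space of exchanges and density\<close>

lemma iet_dist_refl: "iet_dist f f = 0"
  by (simp add: iet_dist_def)

lemma iet_dist_triangle_less:
  assumes "iet_dist f g < ennreal a" "iet_dist g k < ennreal b" "0 < a" "0 < b"
  shows "iet_dist f k < ennreal (a + b)"
proof -
  have "(\<Sum>i = 1..iet_num f. \<bar>iet_length f i - iet_length k i\<bar>) \<le>
      (\<Sum>i = 1..iet_num f. \<bar>iet_length f i - iet_length g i\<bar> + \<bar>iet_length g i - iet_length k i\<bar>)"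
    by (intro sum_mono) linarith
  moreover have ab: "0 < a + b" using assms by simp
  ultimately show ?thesis unfolding iet_dist_less_iff[OF ab] using assms
    by (auto simp: iet_dist_less_iff sum.distrib)
qed

lemma iet_dist_IET_a:
  assumes "f \<in> IET_a" "g \<in> IET" "0 < e" "iet_dist f g < ennreal e"
  shows "g \<in> IET_a"
  using assms by (simp add: IET_a_def iet_dist_less_iff)

text \<open>\<open>T'\<close> has lengths \<open>r + \<delta> v\<close> with \<open>r\<close>
  rational and close to those of \<open>T\<close>. Each \<open>g\<close> within
  \<open>\<delta> / 4\<close> of \<open>T'\<close> satisfies the drift hypotheses of
  \<open>drift_displaces_commutator\<close>, whose constant \<open>m\<close> is fixed before
  \<open>\<delta>\<close>, so \<open>not_free_if_displaced\<close> applies with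
  \<open>p = N!\<close>.\<close>

lemma dense_not_free:
  assumes S: "S \<in> IET" and T: "T \<in> IET_a" and e: "0 < e"
  shows "\<exists>T'\<in>IET. iet_dist T T' < ennreal e \<and> (\<exists>e'>0. \<forall>g\<in>IET. iet_dist T' g < ennreal e' \<longrightarrow>
    \<not> free_of_rank (subgroup_generated iet_group {S, g}) 2)"
proof -
  obtain R where R: "R \<in> IET" "\<forall>x\<in>{0..<1}. S x \<in> {0..<1} \<and> R x \<in> {0..<1} \<and> R (S x) = x \<and> S (R x) = x"
    using IET_inverse[OF S] by blast
  obtain E where E: "finite E" "\<forall>y z. y \<in> {0..<1} \<longrightarrow> z \<in> {0..<1} \<longrightarrow> y \<le> z \<longrightarrow>
    (\<forall>f\<in>E. \<not> (y < f \<and> f \<le> z)) \<longrightarrow> R z - z = R y - y"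
    using IET_local_translation[OF R(1)] by blast
  define n \<sigma> l where "n = iet_num T" and "\<sigma> = iet_perm T" and "l = iet_length T"
  have "T \<in> IET" and adm: "admissible_perm n \<sigma>" using T by (auto simp: IET_a_def n_def \<sigma>_def)
  note st = IET_structure[OF \<open>T \<in> IET\<close>, folded n_def \<sigma>_def l_def]
  have n: "1 \<le> n" using is_lengths_nonempty[OF st(2)] .
  define v where "v j = real j - real (\<sigma> j)" for j
  have v_shift: "1 \<le> shift n \<sigma> v i" if "1 \<le> i" "i \<le> n" for i
    using admissible_shift_pos[OF st(1) adm that] by (simp add: v_def[abs_def])
  have v_le: "\<bar>v i\<bar> \<le> real n" if "i \<in> {1..n}" for i
    using permutes_mem[OF st(1), of i] that by (auto simp: v_def)
  \<comment> \<open>Moving along \<open>v\<close> preserves the total length 1.\<close>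
  have v_sum: "(\<Sum>i = 1..n. v i) = 0"
    using sum.permute[OF st(1), of real] by (simp add: v_def sum_subtractf o_def)
  define V where "V = (\<Sum>i = 1..n. \<bar>v i\<bar>)"
  have V0: "0 \<le> V" by (simp add: V_def sum_nonneg)
  obtain N :: nat and \<beta> :: "nat \<Rightarrow> int" where N: "0 < N" and \<beta>: "\<beta> 0 = 0" "\<beta> n = int N"
    and \<beta>l: "\<forall>i\<in>{1..n}. 1 \<le> \<beta> i - \<beta> (i - 1) \<and> \<bar>(\<beta> i - \<beta> (i - 1)) / N - l i\<bar> < e / (2 * n)"
    using rational_lengths[OF st(2), of "e / (2 * n)"] e n by auto
  define h where "h = 1 / real N"
  define r where "r i = (\<beta> i - \<beta> (i - 1)) * h" for i
  have h: "0 < h" "real N * h = 1" using N by (simp_all add: h_def)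
  have r_ge: "h \<le> r i" if "i \<in> {1..n}" for i
  proof -
    have "1 \<le> \<beta> i - \<beta> (i - 1)" using \<beta>l that by blast
    then have "1 \<le> real_of_int (\<beta> i - \<beta> (i - 1))" by linarith
    then have "1 * h \<le> r i" unfolding r_def using h(1) by (intro mult_right_mono) auto
    then show ?thesis by simp
  qed
  have r_sum: "(\<Sum>i = 1..n. r i) = 1"
  proof -
    have "(\<Sum>i = 1..k. r i) = \<beta> k * h" for k
      by (induction k) (simp_all add: \<beta>(1) r_def algebra_simps)
    then show ?thesis using \<beta>(2) h by simp
  qed
  have r_near: "(\<Sum>i = 1..n. \<bar>l i - r i\<bar>) \<le> e / 2"
  proof -
    have "(\<Sum>i = 1..n. \<bar>l i - r i\<bar>) \<le> (\<Sum>i = 1..n. e / (2 * n))"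
      using \<beta>l by (intro sum_mono) (auto simp: r_def h_def abs_minus_commute less_imp_le)
    then show ?thesis using n by simp
  qed
  \<comment> \<open>The least and greatest drift per unit of \<open>\<delta>\<close> and the
    shrinking of the cells, as supplied by \<open>perturbed_rational_iet\<close>.\<close>
  define a b K where "a = (1 / 2 :: real)" and "b = 2 * V + 1" and "K = V + 1"
  have abK: "0 < a" "a \<le> b" "0 \<le> K" using V0 by (auto simp: a_def b_def K_def)
  have "\<exists>m>0. \<exists>\<delta>\<^sub>0>0. \<forall>\<delta> T (x :: real). 0 < \<delta> \<longrightarrow> \<delta> < \<delta>\<^sub>0 \<longrightarrow>
    (\<forall>x\<in>{0..<1}. T x \<in> {0..<1}) \<longrightarrow> inj_on T {0..<1} \<longrightarrow>
    (\<forall>x\<in>{0..<1}. \<exists>k::int. \<exists>\<epsilon>. a * \<delta> \<le> \<epsilon> \<and> \<epsilon> \<le> b * \<delta> \<and> T x = x + k * h + \<epsilon>) \<longrightarrow>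
    (\<forall>j<N. \<forall>x y. real j * h + K * \<delta> \<le> x \<longrightarrow> x < (real j + 1) * h - K * \<delta> \<longrightarrow>
       real j * h + K * \<delta> \<le> y \<longrightarrow> y < (real j + 1) * h - K * \<delta> \<longrightarrow> T y - y = T x - x) \<longrightarrow>
    x \<in> {0..<1} \<longrightarrow>
    (let A = T ^^ fact N; commutes = (\<lambda>x. A (S (A (R x))) = S (A (R (A x)))) in commutes x \<or> commutes ((T ^^ m) x))"
    unfolding h_def using R(2) E(2)
    by (intro drift_displaces_commutator[OF N abK _ E(1)]) blast+
  then obtain m \<delta>\<^sub>0 where m: "m > 0" and \<delta>\<^sub>0: "\<delta>\<^sub>0 > 0" and
    key: "\<And>\<delta> T x. 0 < \<delta> \<Longrightarrow> \<delta> < \<delta>\<^sub>0 \<Longrightarrow>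
    (\<forall>x\<in>{0..<1}. T x \<in> {0..<1}) \<Longrightarrow> inj_on T {0..<1} \<Longrightarrow>
    (\<forall>x\<in>{0..<1}. \<exists>k::int. \<exists>\<epsilon>. a * \<delta> \<le> \<epsilon> \<and> \<epsilon> \<le> b * \<delta> \<and> T x = x + k * h + \<epsilon>) \<Longrightarrow>
    (\<forall>j<N. \<forall>x y. real j * h + K * \<delta> \<le> x \<longrightarrow> x < (real j + 1) * h - K * \<delta> \<longrightarrow>
       real j * h + K * \<delta> \<le> y \<longrightarrow> y < (real j + 1) * h - K * \<delta> \<longrightarrow> T y - y = T x - x) \<Longrightarrow>
    x \<in> {0..<1} \<Longrightarrow>
    (let A = T ^^ fact N; commutes = (\<lambda>x. A (S (A (R x))) = S (A (R (A x)))) in commutes x \<or> commutes ((T ^^ m) x))"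
    by metis
  \<comment> \<open>The bounds ensure, in order, that \<open>key\<close> applies, that the lengths
    \<open>r + \<delta> v\<close> stay positive (as \<open>\<bar>v i\<bar> \<le> n\<close> and
    \<open>h \<le> r i\<close>), and that \<open>\<delta> * V < e / 2\<close>. The other half of
    \<open>e\<close> is spent on the rational approximation.\<close>
  define \<delta> where "\<delta> = min (\<delta>\<^sub>0 / 2) (min (h / (2 * n)) (e / (4 * (V + 1))))"
  have \<delta>: "0 < \<delta>" "\<delta> < \<delta>\<^sub>0" "\<delta> \<le> h / (2 * n)" "\<delta> \<le> e / (4 * (V + 1))"
    using \<delta>\<^sub>0 h n e V0 by (auto simp: \<delta>_def min_less_iff_disj)
  define l' where "l' i = r i + \<delta> * v i" for i
  have "\<delta> * real n < h" using \<delta>(3) n h(1) by (simp add: field_simps)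
  have l'_pos: "0 < l' i" if "i \<in> {1..n}" for i
  proof -
    have "\<delta> * - v i \<le> \<delta> * real n" using v_le[OF that] \<delta>(1) by (intro mult_left_mono) auto
    then show ?thesis using r_ge[OF that] \<open>\<delta> * real n < h\<close> by (simp add: l'_def)
  qed
  then have l': "is_lengths n l'"
    using r_sum v_sum by (auto simp: is_lengths_def l'_def sum.distrib sum_distrib_left[symmetric])
  define T' where "T' = mk_iet n \<sigma> l'"
  note T' = mk_iet_IET[OF st(1) l' st(4), folded T'_def]
  have "\<delta> * V < e / 2"
  proof -
    have "\<delta> * (4 * (V + 1)) \<le> e" using \<delta>(4) V0 by (simp add: pos_le_divide_eq)
    then show ?thesis using \<delta>(1) e by (simp add: algebra_simps)
  qed
  moreover have "(\<Sum>i = 1..n. \<bar>l i - l' i\<bar>) \<le> (\<Sum>i = 1..n. \<bar>l i - r i\<bar> + \<delta> * \<bar>v i\<bar>)"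
  proof (intro sum_mono)
    fix i
    have "\<bar>\<delta> * v i\<bar> = \<delta> * \<bar>v i\<bar>" using \<delta>(1) by (simp add: abs_mult)
    then show "\<bar>l i - l' i\<bar> \<le> \<bar>l i - r i\<bar> + \<delta> * \<bar>v i\<bar>" unfolding l'_def by linarith
  qed
  then have "(\<Sum>i = 1..n. \<bar>l i - l' i\<bar>) \<le> e / 2 + \<delta> * V"
    using r_near by (simp add: sum.distrib sum_distrib_left[symmetric] V_def)
  ultimately have "(\<Sum>i = 1..n. \<bar>l i - l' i\<bar>) < e" by linarith
  moreover have "(\<Sum>i = 1..n. \<bar>l i - iet_length T' i\<bar>) = (\<Sum>i = 1..n. \<bar>l i - l' i\<bar>)"
    using T'(4) by (intro sum.cong) auto
  ultimately have dist: "iet_dist T T' < ennreal e"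
    using e T'(2,3) by (simp add: iet_dist_less_iff n_def[symmetric] \<sigma>_def[symmetric] l_def[symmetric])
  have "\<not> free_of_rank (subgroup_generated iet_group {S, g}) 2"
    if g: "g \<in> IET" "iet_dist T' g < ennreal (\<delta> / 4)" for g
  proof -
    have gn: "iet_num g = n" "iet_perm g = \<sigma>" and
      gl: "(\<Sum>i = 1..n. \<bar>iet_length T' i - iet_length g i\<bar>) < \<delta> / 4"
      using g(2) \<delta>(1) T'(2,3) by (auto simp: iet_dist_less_iff)
    note gst = IET_structure[OF g(1), unfolded gn]
    define w where "w i = iet_length g i - l' i" for i
    have gw: "iet_length g = (\<lambda>i. r i + \<delta> * v i + w i)" by (simp add: w_def l'_def fun_eq_iff)
    have "(\<Sum>i = 1..n. \<bar>w i\<bar>) = (\<Sum>i = 1..n. \<bar>iet_length T' i - iet_length g i\<bar>)"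
      using T'(4) by (intro sum.cong) (auto simp: w_def abs_minus_commute)
    then have w: "(\<Sum>i = 1..n. \<bar>w i\<bar>) \<le> \<delta> / 4" using gl by simp
    have len: "is_lengths n (\<lambda>i. (\<beta> i - \<beta> (i - 1)) * (1 / real N) + \<delta> * v i + w i)"
      and geq: "g = mk_iet n \<sigma> (\<lambda>i. (\<beta> i - \<beta> (i - 1)) * (1 / real N) + \<delta> * v i + w i)"
      using gst(2,3) unfolding gw r_def h_def by blast+
    note pert = perturbed_rational_iet[OF N \<beta>(1) \<delta>(1) len v_shift eq_refl[OF V_def[symmetric]] w,
      folded geq h_def K_def, folded a_def b_def]
    have bij: "bij_betw g {0..<1} {0..<1}" using g(1) by (simp add: IET_def Bij_def)
    show ?thesis
    proof (rule not_free_if_displaced[OF S g(1) _ m R(1)])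
      show "0 < (fact N :: nat)" by simp
      show "R (S x) = x" if "x \<in> {0..<1}" for x using R(2) that by blast
      show "let A = g ^^ fact N; commutes = (\<lambda>x. A (S (A (R x))) = S (A (R (A x)))) in commutes x \<or> commutes ((g ^^ m) x)"
        if "x \<in> {0..<1}" for x
      proof (rule key[OF \<delta>(1,2) _ _ _ _ that])
        show "\<forall>x\<in>{0..<1}. g x \<in> {0..<1}" using bij bij_betwE by blast
        show "inj_on g {0..<1}" using bij by (rule bij_betw_imp_inj_on)
        show "\<forall>x\<in>{0..<1}. \<exists>k::int. \<exists>\<epsilon>. a * \<delta> \<le> \<epsilon> \<and> \<epsilon> \<le> b * \<delta> \<and> g x = x + k * h + \<epsilon>"
          using pert(1) by blast
        show "\<forall>j<N. \<forall>x y. real j * h + K * \<delta> \<le> x \<longrightarrow> x < (real j + 1) * h - K * \<delta> \<longrightarrow>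
          real j * h + K * \<delta> \<le> y \<longrightarrow> y < (real j + 1) * h - K * \<delta> \<longrightarrow> g y - y = g x - x"
          using pert(2) by blast
      qed
    qed
  qed
  moreover have "0 < \<delta> / 4" using \<delta>(1) by simp
  ultimately show ?thesis using T'(1) dist by blast
qed

theorem theorem1:
  fixes S :: "real \<Rightarrow> real"
  assumes "S \<in> IET"
  shows "\<exists>\<Omega>. openin (subtopology iet_topology IET_a) \<Omega> \<and>
             subtopology iet_topology IET_a closure_of \<Omega> = IET_a \<and>
             (\<forall>T\<in>\<Omega>. \<not> free_of_rank (subgroup_generated iet_group {S, T}) 2)"
proof -
  define not_free where "not_free T \<longleftrightarrow> \<not> free_of_rank (subgroup_generated iet_group {S, T}) 2" for T
  \<comment> \<open>The admissible exchanges with a whole ball of non-free partners. Openness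
    follows from the triangle inequality, and density from \<open>dense_not_free\<close>. Finite
    distance preserves the permutation, so balls around admissible exchanges contain only admissible
    ones.\<close>
  define \<Omega> where "\<Omega> = {T \<in> IET_a. \<exists>e>0. \<forall>g\<in>IET. iet_dist T g < ennreal e \<longrightarrow> not_free g}"
  have sub: "IET_a \<subseteq> IET" by (auto simp: IET_a_def)
  have "iet_open \<Omega>"
    unfolding iet_open_def
  proof (intro conjI ballI)
    show "\<Omega> \<subseteq> IET" using sub by (auto simp: \<Omega>_def)
    fix f assume "f \<in> \<Omega>"
    then obtain e where f: "f \<in> IET_a" and e: "e > 0" "\<And>g. g \<in> IET \<Longrightarrow> iet_dist f g < ennreal e \<Longrightarrow> not_free g"
      by (auto simp: \<Omega>_def)
    have "g \<in> \<Omega>" if g: "g \<in> IET" "iet_dist f g < ennreal (e / 2)" for g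
    proof -
      have "not_free k" if "k \<in> IET" "iet_dist g k < ennreal (e / 2)" for k
        using iet_dist_triangle_less[OF g(2) that(2)] e that(1) by simp
      then show ?thesis
        using iet_dist_IET_a[OF f g(1) _ g(2)] e(1) unfolding \<Omega>_def
        by (intro CollectI conjI exI[of _ "e / 2"]) auto
    qed
    then show "\<exists>e>0. \<forall>g\<in>IET. iet_dist f g < ennreal e \<longrightarrow> g \<in> \<Omega>"
      using e(1) by (intro exI[of _ "e / 2"]) auto
  qed
  then have "openin (subtopology iet_topology IET_a) \<Omega>"
    unfolding openin_subtopology openin_iet_topology by (intro exI[of _ \<Omega>]) (auto simp: \<Omega>_def)
  moreover have "subtopology iet_topology IET_a closure_of \<Omega> = IET_a"
  proof (intro equalityI subsetI)
    fix T assume "T \<in> subtopology iet_topology IET_a closure_of \<Omega>"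
    then show "T \<in> IET_a" by (simp add: in_closure_of)
  next
    fix T assume T: "T \<in> IET_a"
    have "\<exists>T'. T' \<in> \<Omega> \<and> T' \<in> U"
      if U: "T \<in> U" "openin (subtopology iet_topology IET_a) U" for U
    proof -
      obtain U' where U': "iet_open U'" "U = U' \<inter> IET_a"
        using U(2) by (auto simp: openin_subtopology openin_iet_topology)
      then obtain e where e: "e > 0" "\<And>g. g \<in> IET \<Longrightarrow> iet_dist T g < ennreal e \<Longrightarrow> g \<in> U'"
        using U(1) unfolding iet_open_def by blast
      obtain T' where T': "T' \<in> IET" "iet_dist T T' < ennreal e"
        "\<exists>e'>0. \<forall>g\<in>IET. iet_dist T' g < ennreal e' \<longrightarrow> not_free g"
        using dense_not_free[OF assms T e(1)] unfolding not_free_def by blast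
      then have "T' \<in> IET_a" using iet_dist_IET_a[OF T _ e(1)] by blast
      then show ?thesis using T' e(2) U'(2) by (auto simp: \<Omega>_def)
    qed
    then show "T \<in> subtopology iet_topology IET_a closure_of \<Omega>"
      using T sub by (auto simp: in_closure_of topspace_iet_topology)
  qed
  moreover have "not_free T" if T: "T \<in> \<Omega>" for T
  proof -
    obtain e where "e > 0" "\<And>g. g \<in> IET \<Longrightarrow> iet_dist T g < ennreal e \<Longrightarrow> not_free g"
      using T by (auto simp: \<Omega>_def)
    then show ?thesis using T sub by (simp add: \<Omega>_def iet_dist_refl subset_iff)
  qed
  ultimately show ?thesis unfolding not_free_def by blast
qed

end
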